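(* Let $\mathcal{G}$ be the random rooted tree, with root $\rho$, generated by a branching process in which the numbers of offspring of the individuals are i.i.d. non-negative integer-valued random variables with mean $m$, where $1<m<\infty$. Let $\delta>0$ and let $\mathbf{X}=\{X_k,k\ge0\}$ be the once-reinforced random walk on $\mathcal{G}$ with reinforcement parameter $\delta$ and $X_0=\rho$. Then $\mathbf{X}$ is transient.
   Context: Tree: $\mathcal{G}$ is the genealogical (Galton–Watson) tree of a branching process started from a single individual $\rho$ (the root). Write $\nu\sim\mu$ if $\nu$ and $\mu$ are nearest neighbors (joined by an edge). Once-reinforced random walk with parameter $\delta>0$ on a locally finite graph: a discrete-time process $X_k$, $k\ge0$, on the vertices, jumping to nearest neighbors. Initially all edges have weight $1$; when an edge is traversed for the first time its weight becomes $\delta$ and never changes again; the process jumps to a nearest neighbor with probability proportional to the current weight of the connecting edge. Formally, for neighbors $\nu,\mu$ let $G_0(\nu,\mu):=\varnothing$ and, for $k\ge1$, $G_k(\nu,\mu):=\{X_j\in\{\nu,\mu\}\text{ and }X_{j+1}\in\{\nu,\mu\}\text{ for some }0\le j\le k-1\}$; let $z_k(\nu,\mu):=\delta$ on $G_k(\nu,\mu)$ and $z_k(\nu,\mu):=1$ off $G_k(\nu,\mu)$. Given $X_0,\dots,X_k$ with $X_k=\nu$, one has $X_{k+1}=\mu$ with probability $z_k(\nu,\mu)/\sum_{\eta:\eta\sim\nu}z_k(\nu,\eta)$ for each $\mu\sim\nu$. On the random tree $\mathcal{G}$, the process has this law conditionally on $\mathcal{G}$; if $\rho$ has no children, the process stays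 at $\rho$ forever. Terminology: let $\tau:=\inf\{j\ge1:X_j=\rho\}$. Probabilities are with respect to the joint law of the random tree and the walk. The process is transient if $\mathbf{P}(\tau=\infty)>0$, i.e. with positive probability it does not return to its starting point. *)

theory Defs
  imports "HOL-Probability.Probability"
begin

text \<open>
  Individuals are labelled by Ulam--Harris words: \<^term>\<open>[]\<close> is the root, and the children of \<open>v\<close>
  are \<open>v @ [0], \<dots>, v @ [c v - 1]\<close>, where \<open>c v\<close> is the number of offspring of \<open>v\<close>.
  Offspring numbers are attached to every word; those of words outside the tree are not used.
\<close>

type_synonym vertex = "nat list"

definition genealogical_tree :: "(vertex \<Rightarrow> nat) \<Rightarrow> vertex set" where
  "genealogical_tree c = {v. \<forall>k < length v. v ! k < c (take k v)}"

definition tree_adj :: "vertex set \<Rightarrow> vertex \<Rightarrow> vertex \<Rightarrow> bool" where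
  "tree_adj T u v \<longleftrightarrow> u \<in> T \<and> v \<in> T \<and> (\<exists>i. v = u @ [i] \<or> u = v @ [i])"

definition branching_offspring ::
    "'w measure \<Rightarrow> nat pmf \<Rightarrow> (vertex \<Rightarrow> 'w \<Rightarrow> nat) \<Rightarrow> bool" where
  "branching_offspring M p N \<longleftrightarrow>
     prob_space.indep_vars M (\<lambda>_. count_space UNIV) N UNIV \<and>
     (\<forall>v. distr M (count_space UNIV) (N v) = measure_pmf p)"

definition traversed :: "(nat \<Rightarrow> 'v) \<Rightarrow> nat \<Rightarrow> 'v \<Rightarrow> 'v \<Rightarrow> bool" where
  "traversed x k u v \<longleftrightarrow> (\<exists>j < k. x j \<in> {u, v} \<and> x (Suc j) \<in> {u, v})"

definition edge_weight :: "real \<Rightarrow> (nat \<Rightarrow> 'v) \<Rightarrow> nat \<Rightarrow> 'v \<Rightarrow> 'v \<Rightarrow> real" where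
  "edge_weight \<delta> x k u v = (if traversed x k u v then \<delta> else 1)"

text \<open>
  Probability of moving to \<open>v\<close> at time \<open>k + 1\<close> given the trajectory \<open>x\<close> up to time \<open>k\<close>, on a
  locally finite graph with adjacency relation \<open>adj\<close>. At a vertex without neighbours the walk
  stays put; on a tree this concerns only a root without children.
\<close>

definition orrw_step ::
    "('v \<Rightarrow> 'v \<Rightarrow> bool) \<Rightarrow> real \<Rightarrow> (nat \<Rightarrow> 'v) \<Rightarrow> nat \<Rightarrow> 'v \<Rightarrow> real" where
  "orrw_step adj \<delta> x k v =
     (if \<exists>u. adj (x k) u
      then if adj (x k) v
           then edge_weight \<delta> x k (x k) v / (\<Sum>u | adj (x k) u. edge_weight \<delta> x k (x k) u)
           else 0
      else if v = x k then 1 else 0)"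

text \<open>The sigma-algebra generated by the random tree \<open>G\<close> and \<open>X 0, \<dots>, X k\<close>.\<close>

definition history_algebra ::
    "'w measure \<Rightarrow> ('w \<Rightarrow> vertex set) \<Rightarrow> (nat \<Rightarrow> 'w \<Rightarrow> vertex) \<Rightarrow> nat \<Rightarrow> 'w measure" where
  "history_algebra M G X k =
     sigma (space M)
       ({{\<omega> \<in> space M. v \<in> G \<omega>} | v. True} \<union>
        {{\<omega> \<in> space M. X j \<omega> = v} | j v. j \<le> k})"

definition once_reinforced_walk ::
    "'w measure \<Rightarrow> real \<Rightarrow> ('w \<Rightarrow> vertex set) \<Rightarrow> vertex \<Rightarrow> (nat \<Rightarrow> 'w \<Rightarrow> vertex) \<Rightarrow> bool" where
  "once_reinforced_walk M \<delta> G \<rho> X \<longleftrightarrow>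
     (\<forall>k. X k \<in> measurable M (count_space UNIV)) \<and>
     (AE \<omega> in M. X 0 \<omega> = \<rho>) \<and>
     (\<forall>k v. AE \<omega> in M.
        real_cond_exp M (history_algebra M G X k) (indicator {\<omega> \<in> space M. X (Suc k) \<omega> = v}) \<omega> =
        orrw_step (tree_adj (G \<omega>)) \<delta> (\<lambda>j. X j \<omega>) k v)"

definition return_time :: "'v \<Rightarrow> (nat \<Rightarrow> 'v) \<Rightarrow> enat" where
  "return_time \<rho> x = (INF j \<in> {j. 1 \<le> j \<and> x j = \<rho>}. enat j)"

definition transient :: "'w measure \<Rightarrow> 'v \<Rightarrow> (nat \<Rightarrow> 'w \<Rightarrow> 'v) \<Rightarrow> bool" where
  "transient M \<rho> X \<longleftrightarrow> measure M {\<omega> \<in> space M. return_time \<rho> (\<lambda>k. X k \<omega>) = \<infinity>} > 0"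

end

theory Submission
  imports Defs "HOL-Library.Sublist"
begin

text \<open>
  By Rubin's construction the walk is driven by independent clocks, one for each vertex and each of
  its edges, which ring first at rate 1 and then at rate \<open>\<delta>\<close>. The probability that the walk comes
  back from the subtree of a vertex \<open>v\<close> the first \<open>k\<close> times it goes there is obtained by letting the
  clocks of the children of \<open>v\<close> run until the \<open>k\<close>-th ring of the clock of the edge to the parent.
  Given this time the children are independent, so the probability is the expectation over a Gamma
  variable of a product over the children. This recursive formula, extended to the states of the walk,
  solves the first-step equations (by integration by parts), so no clocks have to be constructed.

  The product form survives averaging over the tree, and the averaged formula is the distributional
  recursion of a branching process. Linearised at 1, it is governed by the mean offspring number and by
  the transition operator of the number of crossings of successive edges of a path. The survival
  probability of this chain after \<open>n\<close> steps is the product of \<open>j / (j + \<delta>)\<close> for \<open>j \<le> n\<close>,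
  which decays polynomially and is therefore beaten by the exponential growth of the tree. This gives a
  function below 1 that dominates the averaged return probabilities at all depths.
\<close>

text \<open>While the walk is in the subtree of a vertex, the edge to the parent has already been
  traversed. Its clock therefore runs at rate \<open>\<delta>\<close> throughout and its
  \<open>k\<close>-th ring is Erlang distributed, whereas a child's edge may still be new.

  The offspring law has only a first moment, so the quadratic error of the linearisation is not
  controlled until offspring numbers are capped at some \<open>B\<close> with capped mean still
  above 1. Children of index at least \<open>B\<close> stay in the tree and may be visited; going
  deep through them is merely not counted as escape. Capping also leaves finitely many
  configurations at each depth, so that expectations become finite sums.

  Depth and time are bounded by the same \<open>n\<close>: the walk cannot outrun the depth, no
  stopping time is needed, and the resulting bound does not depend on \<open>n\<close>. Only walks
  that first step to \<open>[0]\<close> are followed. The chance of this is \<open>1 / N []\<close>,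
  which is independent of what happens in the subtree of \<open>[0]\<close>.\<close>

locale orrw =
  fixes \<delta> :: real
  assumes delta_pos: "0 < \<delta>"
begin

section \<open>Clocks of traversed and of new edges\<close>

text \<open>The expectation of \<open>f\<close> at the number of points in \<open>[0, t]\<close> of a Poisson process of rate \<open>\<delta>\<close>.
  It is only meaningful for \<open>t \<ge> 0\<close>.\<close>

definition poisson :: "(nat \<Rightarrow> real) \<Rightarrow> real \<Rightarrow> real" where
  "poisson f t = exp (- (\<delta> * t)) * (\<Sum>j. f j / fact j * (\<delta> * t) ^ j)"

lemma summable_poisson:
  fixes z :: real
  assumes "Bseq f"
  shows "summable (\<lambda>j. f j / fact j * z ^ j)"
proof -
  obtain C where C: "C > 0" "\<And>n. norm (f n) \<le> C"
    using assms by (auto simp: Bseq_def)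
  have "summable (\<lambda>j. C * (inverse (fact j) * \<bar>z\<bar> ^ j))"
    by (intro summable_mult summable_exp)
  then show ?thesis
  proof (rule summable_comparison_test'[where N = 0])
    fix n :: nat
    show "norm (f n / fact n * z ^ n) \<le> C * (inverse (fact n) * \<bar>z\<bar> ^ n)"
      using C(2)[of n] C(1)
      by (simp add: abs_mult power_abs divide_inverse mult.assoc mult_right_mono)
  qed
qed

lemma Bseq_Suc: "Bseq f \<Longrightarrow> Bseq (\<lambda>j. f (Suc j))" for f :: "nat \<Rightarrow> real"
  by (auto simp: Bseq_def)

lemma Bseq_lin:
  fixes f g :: "nat \<Rightarrow> real"
  assumes "Bseq f" "Bseq g"
  shows "Bseq (\<lambda>j. a * f j + b * g j)"
proof -
  obtain C D where "\<And>n. \<bar>f n\<bar> \<le> C" "\<And>n. \<bar>g n\<bar> \<le> D"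
    using assms by (auto simp: Bseq_def)
  then show ?thesis
    by (intro BseqI'[of _ "\<bar>a\<bar> * C + \<bar>b\<bar> * D"])
       (auto simp: abs_mult intro!: order.trans[OF abs_triangle_ineq] add_mono mult_left_mono)
qed

text \<open>Kolmogorov's equation: a ring, at rate \<open>\<delta>\<close>, shifts the argument of
  \<open>f\<close>. For bounded \<open>f\<close> the series is entire, so it holds at every real
  \<open>t\<close>, also where \<open>poisson\<close> is not an expectation.\<close>

lemma has_derivative_poisson:
  assumes "Bseq f"
  shows "(poisson f has_real_derivative \<delta> * (poisson (\<lambda>j. f (Suc j)) t - poisson f t)) (at t)"
proof -
  let ?S = "\<lambda>f z. \<Sum>j. f j / fact j * z ^ j"
  have "(?S f has_field_derivative (\<Sum>n. diffs (\<lambda>j. f j / fact j) n * (\<delta> * t) ^ n)) (at (\<delta> * t))"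
    by (intro termdiffs_strong_converges_everywhere summable_poisson assms)
  also have "(\<lambda>n. diffs (\<lambda>j. f j / fact j) n * (\<delta> * t) ^ n) =
      (\<lambda>n. f (Suc n) / fact n * (\<delta> * t) ^ n)"
    by (auto simp: diffs_def fun_eq_iff)
  finally have D: "(?S f has_field_derivative ?S (\<lambda>j. f (Suc j)) (\<delta> * t)) (at (\<delta> * t))" .
  have "((\<lambda>t. ?S f (\<delta> * t)) has_real_derivative ?S (\<lambda>j. f (Suc j)) (\<delta> * t) * \<delta>) (at t)"
    by (rule DERIV_chain2[OF _ DERIV_cmult_Id]) (rule D)
  then show ?thesis
    unfolding poisson_def
    by (auto intro!: derivative_eq_intros simp: algebra_simps)
qed

lemma continuous_on_poisson: "Bseq f \<Longrightarrow> continuous_on S (poisson f)"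
  by (meson DERIV_continuous_on has_derivative_poisson has_field_derivative_at_within)

lemma poisson_0: "poisson f 0 = f 0"
  using powser_zero[of "\<lambda>j. f j / fact j"] by (simp add: poisson_def)

lemma poisson_lin:
  assumes "Bseq f" "Bseq g"
  shows "poisson (\<lambda>j. a * f j + b * g j) t = a * poisson f t + b * poisson g t"
proof -
  have "(\<Sum>j. (a * f j + b * g j) / fact j * (\<delta> * t) ^ j) =
      (\<Sum>j. a * (f j / fact j * (\<delta> * t) ^ j) + b * (g j / fact j * (\<delta> * t) ^ j))"
    by (intro suminf_cong) (simp add: add_divide_distrib ring_distribs mult.assoc)
  also have "\<dots> = a * (\<Sum>j. f j / fact j * (\<delta> * t) ^ j) + b * (\<Sum>j. g j / fact j * (\<delta> * t) ^ j)"
    using summable_poisson[OF assms(1), of "\<delta> * t"] summable_poisson[OF assms(2), of "\<delta> * t"]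
    by (subst suminf_add[symmetric]) (auto simp only: suminf_mult intro!: summable_mult)
  finally show ?thesis
    by (simp add: poisson_def algebra_simps)
qed

lemma poisson_nonneg:
  assumes "Bseq f" "\<And>j. 0 \<le> f j" "0 \<le> t"
  shows "0 \<le> poisson f t"
  unfolding poisson_def
  using assms delta_pos by (intro mult_nonneg_nonneg suminf_nonneg summable_poisson) auto

lemma poisson_geometric: "poisson (\<lambda>j. s ^ j) t = exp (- (\<delta> * (1 - s) * t))"
proof -
  have "(\<Sum>j. s ^ j / fact j * (\<delta> * t) ^ j) = exp (s * (\<delta> * t))"
    by (simp add: exp_def power_mult_distrib field_simps)
  then show ?thesis
    by (simp add: poisson_def exp_add[symmetric] algebra_simps)
qed

lemma poisson_const: "poisson (\<lambda>j. c) t = c"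
proof -
  have "poisson (\<lambda>j. c * 1 ^ j + 0 * 1 ^ j) t = c * poisson (\<lambda>j. 1 ^ j) t + 0 * poisson (\<lambda>j. 1 ^ j) t"
    by (rule poisson_lin) (auto intro: Bfun_const)
  then show ?thesis
    using poisson_geometric[of 1 t] by simp
qed

text \<open>The same for the clock of an edge that has not been traversed: it rings for the first time at
  rate 1 and at rate \<open>\<delta>\<close> afterwards.\<close>

definition delayed :: "(nat \<Rightarrow> real) \<Rightarrow> real \<Rightarrow> real" where
  "delayed f t = exp (- t) * (f 0 + (LBINT u=0..t. exp u * poisson (\<lambda>j. f (Suc j)) u))"

lemma delayed_0: "delayed f 0 = f 0"
  by (simp add: delayed_def zero_ereal_def[symmetric])

text \<open>\<open>delayed\<close> conditions on the first ring, at time \<open>t - u\<close>, after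
  which the clock runs for \<open>u\<close> at rate \<open>\<delta>\<close>. The rate 1 before that
  ring is the factor 1 in front of the difference.\<close>

lemma has_derivative_delayed:
  assumes "Bseq f"
  shows "(delayed f has_real_derivative (poisson (\<lambda>j. f (Suc j)) t - delayed f t)) (at t)"
proof -
  let ?g = "\<lambda>u. exp u * poisson (\<lambda>j. f (Suc j)) u"
  have cont: "continuous_on S ?g" for S
    by (intro continuous_intros continuous_on_poisson Bseq_Suc assms)
  \<comment> \<open>A symmetric interval has the base point 0 and a \<open>t\<close> of either sign
    in its interior, so the derivative within it is a full derivative.\<close>
  define a where "a = \<bar>t\<bar> + 1"
  have "((\<lambda>u. LBINT y=ereal 0..u. ?g y) has_vector_derivative ?g t) (at t within {-a..a})"
    by (rule interval_integral_FTC2) (auto simp: a_def cont)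
  moreover have "at t within {-a..a} = at t"
    by (rule at_within_interior) (auto simp: a_def)
  ultimately have "((\<lambda>u. LBINT y=0..u. ?g y) has_real_derivative ?g t) (at t)"
    by (simp add: has_real_derivative_iff_has_vector_derivative zero_ereal_def)
  then show ?thesis
    unfolding delayed_def
    by (auto intro!: derivative_eq_intros simp: algebra_simps exp_minus)
qed

lemma continuous_on_delayed: "Bseq f \<Longrightarrow> continuous_on S (delayed f)"
  by (meson DERIV_continuous_on has_derivative_delayed has_field_derivative_at_within)

text \<open>Multiplied by the integrating factor \<open>exp t\<close>, the difference of two
  solutions is constant. Closed forms of \<open>delayed\<close> are identified in this way, without
  evaluating its integral.\<close>

lemma delayed_unique:
  assumes "Bseq f" "D 0 = f 0"
    and "\<And>t. (D has_real_derivative (poisson (\<lambda>j. f (Suc j)) t - D t)) (at t)"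
  shows "D t = delayed f t"
proof -
  have "((\<lambda>t. exp t * (D t - delayed f t)) has_real_derivative 0) (at t)" for t
    by (rule derivative_eq_intros assms(3) has_derivative_delayed[OF assms(1)] refl)+
       (simp add: algebra_simps)
  then have "exp t * (D t - delayed f t) = exp 0 * (D 0 - delayed f 0)"
    using DERIV_isconst_all[of "\<lambda>t. exp t * (D t - delayed f t)" t 0] by blast
  then show ?thesis
    using assms(2) by (simp add: delayed_0)
qed

lemma delayed_lin:
  assumes "Bseq f" "Bseq g"
  shows "delayed (\<lambda>j. a * f j + b * g j) t = a * delayed f t + b * delayed g t"
proof -
  have B: "Bseq (\<lambda>j. a * f j + b * g j)"
    using assms by (rule Bseq_lin)
  have "a * delayed f t + b * delayed g t = delayed (\<lambda>j. a * f j + b * g j) t" for t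
  proof (rule delayed_unique[of "\<lambda>j. a * f j + b * g j" "\<lambda>t. a * delayed f t + b * delayed g t", OF B])
    show "((\<lambda>t. a * delayed f t + b * delayed g t) has_real_derivative
        poisson (\<lambda>j. a * f (Suc j) + b * g (Suc j)) t - (a * delayed f t + b * delayed g t)) (at t)" for t
      using assms
      by (auto intro!: derivative_eq_intros has_derivative_delayed simp: poisson_lin Bseq_Suc algebra_simps)
  qed (simp add: delayed_0)
  then show ?thesis ..
qed

lemma delayed_nonneg:
  assumes "Bseq f" "\<And>j. 0 \<le> f j" "0 \<le> t"
  shows "0 \<le> delayed f t"
proof -
  have "exp 0 * delayed f 0 \<le> exp t * delayed f t"
  proof (rule DERIV_nonneg_imp_nondecreasing[OF assms(3)])
    fix x assume x: "0 \<le> x" "x \<le> t"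
    have "((\<lambda>t. exp t * delayed f t) has_real_derivative exp x * poisson (\<lambda>j. f (Suc j)) x) (at x)"
      by (rule derivative_eq_intros has_derivative_delayed[OF assms(1)] refl)+ (simp add: algebra_simps)
    moreover have "0 \<le> exp x * poisson (\<lambda>j. f (Suc j)) x"
      using assms x by (intro mult_nonneg_nonneg poisson_nonneg Bseq_Suc) auto
    ultimately show "\<exists>y. ((\<lambda>t. exp t * delayed f t) has_real_derivative y) (at x) \<and> 0 \<le> y"
      by blast
  qed
  then have "0 \<le> exp t * delayed f t"
    using assms(2)[of 0] by (simp add: delayed_0)
  then show ?thesis
    by (simp add: zero_le_mult_iff)
qed

lemma delayed_const: "delayed (\<lambda>j. c) t = c"
  by (rule delayed_unique[symmetric, of "\<lambda>j. c" "\<lambda>t. c"]) (auto simp: poisson_const)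

text \<open>The flag records whether the edge has been traversed. Either kind continues as
  \<open>poisson\<close> after its next ring, which is why \<open>has_derivative_clock\<close> has a
  single form.\<close>

definition clock :: "bool \<Rightarrow> (nat \<Rightarrow> real) \<Rightarrow> real \<Rightarrow> real" where
  "clock b = (if b then poisson else delayed)"

definition rate :: "bool \<Rightarrow> real" where
  "rate b = (if b then \<delta> else 1)"

lemma has_derivative_clock:
  "Bseq f \<Longrightarrow> (clock b f has_real_derivative rate b * (poisson (\<lambda>j. f (Suc j)) t - clock b f t)) (at t)"
  by (simp add: clock_def rate_def has_derivative_poisson has_derivative_delayed)

lemma continuous_on_clock: "Bseq f \<Longrightarrow> continuous_on S (clock b f)"
  by (simp add: clock_def continuous_on_poisson continuous_on_delayed)

lemma clock_0: "clock b f 0 = f 0"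
  by (simp add: clock_def poisson_0 delayed_0)

lemma clock_lin:
  "Bseq f \<Longrightarrow> Bseq g \<Longrightarrow> clock b (\<lambda>j. a * f j + c * g j) t = a * clock b f t + c * clock b g t"
  by (simp add: clock_def poisson_lin delayed_lin)

lemma clock_nonneg: "Bseq f \<Longrightarrow> (\<And>j. 0 \<le> f j) \<Longrightarrow> 0 \<le> t \<Longrightarrow> 0 \<le> clock b f t"
  by (simp add: clock_def poisson_nonneg delayed_nonneg)

lemma clock_const: "clock b (\<lambda>j. c) t = c"
  by (simp add: clock_def poisson_const delayed_const)

lemma clock_mono:
  assumes "Bseq f" "Bseq g" "\<And>j. f j \<le> g j" "0 \<le> t"
  shows "clock b f t \<le> clock b g t"
proof -
  have "Bseq (\<lambda>j. 1 * g j + (-1) * f j)"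
    using assms(1,2) by (intro Bseq_lin)
  then have "0 \<le> clock b (\<lambda>j. 1 * g j + (-1) * f j) t"
    using assms by (intro clock_nonneg) auto
  then show ?thesis
    using assms by (simp only: clock_lin)
qed

lemma Bseq_unit: "(\<And>j. 0 \<le> f j \<and> f j \<le> 1) \<Longrightarrow> Bseq f" for f :: "nat \<Rightarrow> real"
  by (intro BseqI'[of _ 1]) (simp add: abs_le_iff) 

lemma clock_unit:
  assumes "\<And>j. 0 \<le> f j \<and> f j \<le> 1" "0 \<le> t"
  shows "0 \<le> clock b f t" "clock b f t \<le> 1"
  using clock_nonneg[of f t b] clock_mono[of f "\<lambda>_. 1" t b] assms Bseq_unit[of f]
  by (auto simp: clock_const Bfun_const)

text \<open>Boundedness is asked only on the half-line: Erlang densities vanish at negative times,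
  where functions such as \<open>exp (- t)\<close> blow up.\<close>

definition tame :: "(real \<Rightarrow> real) \<Rightarrow> bool" where
  "tame G \<longleftrightarrow> continuous_on UNIV G \<and> (\<exists>C. \<forall>t\<ge>0. \<bar>G t\<bar> \<le> C)"

lemma tameI: "continuous_on UNIV G \<Longrightarrow> (\<And>t. 0 \<le> t \<Longrightarrow> \<bar>G t\<bar> \<le> C) \<Longrightarrow> tame G"
  by (auto simp: tame_def)

lemma tame_const [intro]: "tame (\<lambda>_. c)"
  by (rule tameI[of _ "\<bar>c\<bar>"]) auto

lemma tame_lin [intro]:
  assumes "tame G" "tame H"
  shows "tame (\<lambda>t. a * G t + b * H t)"
proof -
  obtain C D where "\<And>t. 0 \<le> t \<Longrightarrow> \<bar>G t\<bar> \<le> C" "\<And>t. 0 \<le> t \<Longrightarrow> \<bar>H t\<bar> \<le> D"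
    using assms by (auto simp: tame_def)
  then show ?thesis
    using assms
    by (intro tameI[of _ "\<bar>a\<bar> * C + \<bar>b\<bar> * D"])
       (auto simp: abs_mult tame_def intro!: continuous_intros order.trans[OF abs_triangle_ineq] add_mono mult_left_mono)
qed

lemma tame_mult [intro]:
  assumes "tame G" "tame H"
  shows "tame (\<lambda>t. G t * H t)"
proof -
  obtain C D where C: "\<And>t. 0 \<le> t \<Longrightarrow> \<bar>G t\<bar> \<le> C" and D: "\<And>t. 0 \<le> t \<Longrightarrow> \<bar>H t\<bar> \<le> D"
    using assms by (auto simp: tame_def)
  have "0 \<le> C"
    using C[of 0] by simp
  then show ?thesis
    using assms C D
    by (intro tameI[of _ "C * D"])
       (auto simp: abs_mult tame_def intro!: continuous_intros mult_mono)
qed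

lemma tame_prod:
  assumes "\<And>i. i \<in> I \<Longrightarrow> tame (G i)"
  shows "tame (\<lambda>t. \<Prod>i\<in>I. G i t)"
  using assms by (induction I rule: infinite_finite_induct) auto

lemma tame_sum:
  assumes "\<And>i. i \<in> I \<Longrightarrow> tame (G i)"
  shows "tame (\<lambda>t. \<Sum>i\<in>I. G i t)"
  using assms
proof (induction I rule: infinite_finite_induct)
  case (insert i I)
  then have "tame (\<lambda>t. 1 * G i t + 1 * (\<Sum>i\<in>I. G i t))"
    by (intro tame_lin) auto
  then show ?case
    using insert by simp
qed auto

lemma tame_clock:
  assumes "Bseq f"
  shows "tame (clock b f)"
proof -
  obtain C where C: "\<And>j. \<bar>f j\<bar> \<le> C"
    using assms by (auto simp: Bseq_def)
  have "\<bar>clock b f t\<bar> \<le> C" if "0 \<le> t" for t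
  proof -
    have "f j \<le> C" "- C \<le> f j" for j
      using C[of j] by linarith+
    then show ?thesis
      using clock_mono[OF assms _ _ that, of "\<lambda>_. C" b] clock_mono[OF _ assms _ that, of "\<lambda>_. - C" b]
      by (auto simp: clock_const Bfun_const abs_le_iff)
  qed
  then show ?thesis
    by (intro tameI continuous_on_clock assms)
qed

text \<open>The expectation of \<open>G\<close> at the time of the \<open>k\<close>-th ring of a clock of rate \<open>\<delta>\<close>.\<close>

definition gamma_mean :: "nat \<Rightarrow> (real \<Rightarrow> real) \<Rightarrow> real" where
  "gamma_mean k G = (case k of 0 \<Rightarrow> G 0 | Suc j \<Rightarrow> LBINT t. erlang_density j \<delta> t * G t)"

lemma gamma_mean_0: "gamma_mean 0 G = G 0"
  by (simp add: gamma_mean_def)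

lemma has_bochner_integral_erlang_density:
  "has_bochner_integral lborel (erlang_density j \<delta>) 1"
  using nn_integral_erlang_ith_moment[OF delta_pos, of j 0] delta_pos
  by (intro has_bochner_integral_nn_integral) (auto simp: less_imp_le)

lemma integrable_erlang_mult:
  assumes "tame G"
  shows "integrable lborel (\<lambda>t. erlang_density j \<delta> t * G t)"
proof -
  obtain C where C: "\<And>t. 0 \<le> t \<Longrightarrow> \<bar>G t\<bar> \<le> C"
    using assms by (auto simp: tame_def)
  have [measurable]: "G \<in> borel_measurable borel"
    using assms by (auto simp: tame_def intro: borel_measurable_continuous_onI)
  have "integrable lborel (\<lambda>t. erlang_density j \<delta> t * C)"
    using has_bochner_integral_erlang_density[of j]
    by (intro integrable_mult_left) (auto simp: has_bochner_integral_iff)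
  then show ?thesis
  proof (rule Bochner_Integration.integrable_bound)
    show "AE t in lborel. norm (erlang_density j \<delta> t * G t) \<le> norm (erlang_density j \<delta> t * C)"
    proof (rule AE_I2)
      fix t :: real
      show "norm (erlang_density j \<delta> t * G t) \<le> norm (erlang_density j \<delta> t * C)"
      proof (cases "0 \<le> t")
        case True
        then show ?thesis
          using C[OF True] by (auto simp: abs_mult intro!: mult_left_mono)
      qed (simp add: erlang_density_def)
    qed
  qed simp
qed

lemma gamma_mean_const: "gamma_mean k (\<lambda>_. c) = c"
  using has_bochner_integral_erlang_density
  by (auto simp: gamma_mean_def has_bochner_integral_iff split: nat.split)

lemma gamma_mean_lin:
  assumes "tame G" "tame H"
  shows "gamma_mean k (\<lambda>t. a * G t + b * H t) = a * gamma_mean k G + b * gamma_mean k H"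
proof (cases k)
  case (Suc j)
  have "(LBINT t. erlang_density j \<delta> t * (a * G t + b * H t)) =
      (LBINT t. a * (erlang_density j \<delta> t * G t) + b * (erlang_density j \<delta> t * H t))"
    by (simp add: algebra_simps)
  also have "\<dots> = a * (LBINT t. erlang_density j \<delta> t * G t) + b * (LBINT t. erlang_density j \<delta> t * H t)"
    using integrable_erlang_mult[OF assms(1), of j] integrable_erlang_mult[OF assms(2), of j]
    by simp
  finally show ?thesis
    by (simp add: gamma_mean_def Suc)
qed (simp add: gamma_mean_def)

lemma gamma_mean_sum:
  assumes "\<And>i. i \<in> I \<Longrightarrow> tame (G i)"
  shows "gamma_mean k (\<lambda>t. \<Sum>i\<in>I. G i t) = (\<Sum>i\<in>I. gamma_mean k (G i))"
  using assms
proof (induction I rule: infinite_finite_induct)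
  case (insert i I)
  then have "gamma_mean k (\<lambda>t. 1 * G i t + 1 * (\<Sum>i\<in>I. G i t)) = 1 * gamma_mean k (G i) + 1 * gamma_mean k (\<lambda>t. \<Sum>i\<in>I. G i t)"
    by (intro gamma_mean_lin tame_sum) auto
  then show ?case
    using insert by simp
qed (auto simp: gamma_mean_const)

lemma gamma_mean_mono:
  assumes "tame G" "tame H" "\<And>t. 0 \<le> t \<Longrightarrow> G t \<le> H t"
  shows "gamma_mean k G \<le> gamma_mean k H"
proof (cases k)
  case (Suc j)
  have "(LBINT t. erlang_density j \<delta> t * G t) \<le> (LBINT t. erlang_density j \<delta> t * H t)"
  proof (intro integral_mono integrable_erlang_mult assms)
    fix t :: real
    show "erlang_density j \<delta> t * G t \<le> erlang_density j \<delta> t * H t"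
      using assms(3)[of t] delta_pos
      by (cases "0 \<le> t") (simp_all add: mult_left_mono, simp add: erlang_density_def)
  qed
  then show ?thesis
    by (simp add: gamma_mean_def Suc)
qed (use assms(3)[of 0] in \<open>simp add: gamma_mean_def\<close>)

lemma gamma_mean_unit:
  assumes "tame G" "\<And>t. 0 \<le> t \<Longrightarrow> 0 \<le> G t \<and> G t \<le> 1"
  shows "0 \<le> gamma_mean k G" "gamma_mean k G \<le> 1"
  using gamma_mean_mono[of "\<lambda>_. 0" G k] gamma_mean_mono[of G "\<lambda>_. 1" k] assms by (auto simp: gamma_mean_const)

text \<open>On the open half-line the density loses its case distinction and becomes smooth, as the
  fundamental theorem of calculus requires; only the null set of the point 0 is lost.\<close>

lemma integral_erlang_mult:
  assumes "tame G"
  shows "(LBINT t. erlang_density j \<delta> t * G t) =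
     (LBINT t=0..\<infinity>. (\<delta> ^ Suc j * t ^ j * exp (- \<delta> * t)) / fact j * G t)"
    and "set_integrable lborel (einterval 0 \<infinity>) (\<lambda>t. (\<delta> ^ Suc j * t ^ j * exp (- \<delta> * t)) / fact j * G t)"
proof -
  let ?e = "\<lambda>t. (\<delta> ^ Suc j * t ^ j * exp (- \<delta> * t)) / fact j * G t"
  have [measurable]: "G \<in> borel_measurable borel"
    using assms by (auto simp: tame_def intro: borel_measurable_continuous_onI)
  have ae: "AE t in lborel. erlang_density j \<delta> t * G t = indicator (einterval 0 \<infinity>) t *\<^sub>R ?e t"
    using AE_lborel_singleton[of "0::real"]
  proof eventually_elim
    case (elim t)
    then show ?case
      by (auto simp: erlang_density_def einterval_def indicator_def zero_ereal_def)
  qed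
  show "(LBINT t. erlang_density j \<delta> t * G t) = (LBINT t=0..\<infinity>. ?e t)"
    unfolding interval_lebesgue_integral_def set_lebesgue_integral_def
    using integral_cong_AE[OF _ _ ae] by simp
  show "set_integrable lborel (einterval 0 \<infinity>) ?e"
    unfolding set_integrable_def
    by (rule integrable_cong_AE_imp[OF integrable_erlang_mult[OF assms, of j] _ ae]) simp
qed

lemma poly_exp_tendsto_0: "((\<lambda>t. t ^ j * exp (- \<delta> * t)) \<longlongrightarrow> 0) at_top"
proof -
  have "((\<lambda>t. (\<delta> * t) ^ j / exp (\<delta> * t)) \<longlongrightarrow> 0) at_top"
    by (rule filterlim_compose[OF tendsto_power_div_exp_0])
       (use delta_pos in \<open>auto intro!: filterlim_tendsto_pos_mult_at_top[OF tendsto_const] filterlim_ident\<close>)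
  then have "((\<lambda>t. inverse (\<delta> ^ j) * ((\<delta> * t) ^ j / exp (\<delta> * t))) \<longlongrightarrow> inverse (\<delta> ^ j) * 0) at_top"
    by (intro tendsto_mult tendsto_const)
  then show ?thesis
    using delta_pos by (simp add: power_mult_distrib exp_minus field_simps)
qed

text \<open>Integration by parts against the Erlang densities.\<close>

lemma gamma_mean_deriv:
  assumes G: "tame G" and H: "tame H"
    and D: "\<And>t. (G has_real_derivative H t) (at t)"
  shows "gamma_mean (Suc k) H = \<delta> * (gamma_mean (Suc k) G - gamma_mean k G)"
proof -
  define e where "e = (\<lambda>j t. (\<delta> ^ Suc j * t ^ j * exp (- \<delta> * t)) / fact j)"
  \<comment> \<open>The derivative of \<open>e k\<close> is
    \<open>\<delta> * (e (k - 1) - e k)\<close>. For \<open>k = 0\<close> the preceding law is the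
    point mass at 0, which has no density: \<open>e'\<close> is 0 and the missing
    \<open>\<delta> * G 0\<close> comes from the boundary value at 0.\<close>
  define e' where "e' = (\<lambda>t. case k of 0 \<Rightarrow> 0 | Suc i \<Rightarrow> e i t)"
  have e_deriv: "(e k has_real_derivative \<delta> * (e' t - e k t)) (at t)" for t
  proof (cases k)
    case (Suc i)
    define c where "c = \<delta> ^ Suc k / fact k"
    have c: "c * real (Suc i) = \<delta> * (\<delta> ^ Suc i / fact i)"
      by (simp add: c_def Suc divide_simps del: of_nat_Suc)
    have "((\<lambda>t. t ^ Suc i * exp (- \<delta> * t)) has_real_derivative
        real (Suc i) * (t ^ i * exp (- \<delta> * t)) - \<delta> * (t ^ Suc i * exp (- \<delta> * t))) (at t)"
      by (rule derivative_eq_intros refl)+ (simp add: algebra_simps)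
    then have "((\<lambda>t. c * (t ^ Suc i * exp (- \<delta> * t))) has_real_derivative
        c * (real (Suc i) * (t ^ i * exp (- \<delta> * t)) - \<delta> * (t ^ Suc i * exp (- \<delta> * t)))) (at t)"
      by (rule DERIV_cmult)
    moreover have "c * (real (Suc i) * (t ^ i * exp (- \<delta> * t)) - \<delta> * (t ^ Suc i * exp (- \<delta> * t))) =
        \<delta> * (e' t - e k t)"
      unfolding right_diff_distrib mult.assoc[symmetric] c
      by (simp add: e_def e'_def c_def Suc mult_ac right_diff_distrib)
    moreover have "(\<lambda>t. c * (t ^ Suc i * exp (- \<delta> * t))) = e k"
      by (simp add: e_def c_def Suc mult.assoc)
    ultimately show ?thesis
      by simp
  qed (auto simp: e_def e'_def intro!: derivative_eq_intros)
  obtain C where C: "\<And>t. 0 \<le> t \<Longrightarrow> \<bar>G t\<bar> \<le> C"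
    using G by (auto simp: tame_def)
  have cont [simp]: "isCont G x" "isCont H x" "isCont (e j) x" "isCont e' x" for x j
    using G H by (auto simp: tame_def continuous_on_eq_continuous_at e_def)
       (cases k; auto simp: e'_def e_def)
  have ie: "set_integrable lborel (einterval 0 \<infinity>) (\<lambda>t. e j t * G t)"
    "set_integrable lborel (einterval 0 \<infinity>) (\<lambda>t. e j t * H t)" for j
    using integral_erlang_mult(2)[OF G] integral_erlang_mult(2)[OF H] by (auto simp: e_def)
  have ie': "set_integrable lborel (einterval 0 \<infinity>) (\<lambda>t. e' t * G t)"
    using ie(1) by (cases k) (auto simp: e'_def set_integrable_def)
  have iis: "set_integrable lborel (einterval 0 \<infinity>) (\<lambda>t. \<delta> * (e' t * G t - e k t * G t))"
    using ie(1)[of k] ie' by (intro set_integrable_mult_right set_integral_diff)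
  have lim_inf: "((\<lambda>t. e k t * G t) \<longlongrightarrow> 0) at_top"
  proof (rule Lim_null_comparison)
    show "\<forall>\<^sub>F t in at_top. norm (e k t * G t) \<le> \<delta> ^ Suc k / fact k * C * (t ^ k * exp (- \<delta> * t))"
      using eventually_ge_at_top[of 0]
    proof eventually_elim
      case (elim t)
      have "norm (e k t * G t) = \<delta> ^ Suc k / fact k * (t ^ k * exp (- \<delta> * t)) * \<bar>G t\<bar>"
        using elim delta_pos by (simp add: e_def abs_mult)
      also have "\<dots> \<le> \<delta> ^ Suc k / fact k * (t ^ k * exp (- \<delta> * t)) * C"
        using elim delta_pos C[OF elim] by (intro mult_left_mono) auto
      finally show ?case
        by (simp add: algebra_simps)
    qed
    show "((\<lambda>t. \<delta> ^ Suc k / fact k * C * (t ^ k * exp (- \<delta> * t))) \<longlongrightarrow> 0) at_top"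
      using tendsto_mult[OF tendsto_const poly_exp_tendsto_0, of "\<delta> ^ Suc k / fact k * C" k] by simp
  qed
  have "(LBINT t=0..\<infinity>. e k t * H t + \<delta> * (e' t * G t - e k t * G t)) = 0 - e k 0 * G 0"
  proof (rule interval_integral_FTC_integrable)
    show "((\<lambda>t. e k t * G t) has_vector_derivative e k x * H x + \<delta> * (e' x * G x - e k x * G x)) (at x)" for x
      unfolding has_real_derivative_iff_has_vector_derivative[symmetric]
      by (rule derivative_eq_intros e_deriv D refl)+ (simp add: algebra_simps)
    show "set_integrable lborel (einterval 0 \<infinity>) (\<lambda>t. e k t * H t + \<delta> * (e' t * G t - e k t * G t))"
      by (rule set_integral_add(1)[OF ie(2) iis])
    have "((\<lambda>t. e k t * G t) \<longlongrightarrow> e k 0 * G 0) (at_right 0)"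
      using isCont_mult[OF cont(3)[of 0 k] cont(1)[of 0]] by (simp add: isCont_def filterlim_at_split)
    then show "(((\<lambda>t. e k t * G t) \<circ> real_of_ereal) \<longlongrightarrow> e k 0 * G 0) (at_right 0)"
      by (simp add: zero_ereal_def ereal_tendsto_simps1)
    show "(((\<lambda>t. e k t * G t) \<circ> real_of_ereal) \<longlongrightarrow> 0) (at_left \<infinity>)"
      using lim_inf by (simp add: ereal_tendsto_simps1)
  qed (auto intro!: continuous_intros)
  moreover have "(LBINT t=0..\<infinity>. e k t * H t + \<delta> * (e' t * G t - e k t * G t)) =
      (LBINT t=0..\<infinity>. e k t * H t) + \<delta> * ((LBINT t=0..\<infinity>. e' t * G t) - (LBINT t=0..\<infinity>. e k t * G t))"
    using ie(1)[of k] ie' iis ie(2)[of k]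
    by (simp add: interval_lebesgue_integral_def set_integral_add(2) set_integral_diff(2))
  moreover have "(LBINT t=0..\<infinity>. e j t * G t) = gamma_mean (Suc j) G" "(LBINT t=0..\<infinity>. e j t * H t) = gamma_mean (Suc j) H" for j
    using integral_erlang_mult(1)[OF G] integral_erlang_mult(1)[OF H] by (auto simp: e_def gamma_mean_def)
  moreover have "(LBINT t=0..\<infinity>. e' t * G t) * \<delta> + e k 0 * G 0 = gamma_mean k G * \<delta>"
  proof (cases k)
    case 0
    then show ?thesis
      by (simp add: e'_def e_def gamma_mean_0)
  next
    case (Suc i)
    then show ?thesis
      using calculation(3) by (simp add: e'_def) (simp add: e_def)
  qed
  ultimately show ?thesis
    by (simp add: algebra_simps)
qed

lemma tame_exp: "0 \<le> c \<Longrightarrow> tame (\<lambda>t. exp (- (c * t)))"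
  by (rule tameI[of _ 1]) (auto intro!: continuous_intros)

text \<open>Differentiation multiplies the exponential by \<open>- c\<close>, so integration by
  parts becomes a recursion in \<open>k\<close> for the Laplace transform of the Gamma law.\<close>

lemma gamma_mean_exp:
  assumes "0 \<le> c"
  shows "gamma_mean k (\<lambda>t. exp (- (c * t))) = (\<delta> / (\<delta> + c)) ^ k"
proof (induction k)
  case (Suc k)
  have t: "tame (\<lambda>t. exp (- (c * t)))"
    using assms by (rule tame_exp)
  have t': "tame (\<lambda>t. - c * exp (- (c * t)))"
    using tame_lin[OF t t, of "- c" 0] by simp
  have "gamma_mean (Suc k) (\<lambda>t. - c * exp (- (c * t))) =
      \<delta> * (gamma_mean (Suc k) (\<lambda>t. exp (- (c * t))) - gamma_mean k (\<lambda>t. exp (- (c * t))))"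
    by (rule gamma_mean_deriv[OF t t']) (auto intro!: derivative_eq_intros)
  moreover have "gamma_mean (Suc k) (\<lambda>t. - c * exp (- (c * t))) = - c * gamma_mean (Suc k) (\<lambda>t. exp (- (c * t)))"
    using gamma_mean_lin[OF t t, of "Suc k" "- c" 0] by simp
  ultimately have "(\<delta> + c) * gamma_mean (Suc k) (\<lambda>t. exp (- (c * t))) = \<delta> * gamma_mean k (\<lambda>t. exp (- (c * t)))"
    by (simp add: algebra_simps)
  then have "gamma_mean (Suc k) (\<lambda>t. exp (- (c * t))) = \<delta> / (\<delta> + c) * gamma_mean k (\<lambda>t. exp (- (c * t)))"
    using assms delta_pos by (simp add: field_simps)
  then show ?case
    by (simp add: Suc)
qed (simp add: gamma_mean_0)

subsection \<open>A supercritical test function on crossing numbers\<close>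

text \<open>On a path, \<open>trans_op\<close> is the transition operator of the chain that gives the number of
  crossings of each edge in terms of the number of crossings of the previous one.\<close>

definition trans_op :: "(nat \<Rightarrow> real) \<Rightarrow> nat \<Rightarrow> real" where
  "trans_op F k = gamma_mean k (delayed F)"

lemma tame_delayed: "Bseq f \<Longrightarrow> tame (delayed f)"
  using tame_clock[of f False] by (simp add: clock_def)

lemma tame_poisson: "Bseq f \<Longrightarrow> tame (poisson f)"
  using tame_clock[of f True] by (simp add: clock_def)

lemma trans_op_0: "trans_op F 0 = F 0"
  by (simp add: trans_op_def gamma_mean_0 delayed_0)

lemma trans_op_lin:
  assumes "Bseq F" "Bseq G"
  shows "trans_op (\<lambda>k. a * F k + b * G k) = (\<lambda>k. a * trans_op F k + b * trans_op G k)"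
proof
  fix k
  have "delayed (\<lambda>k. a * F k + b * G k) = (\<lambda>t. a * delayed F t + b * delayed G t)"
    using assms by (intro ext delayed_lin)
  then show "trans_op (\<lambda>k. a * F k + b * G k) k = a * trans_op F k + b * trans_op G k"
    unfolding trans_op_def using assms by (simp only: gamma_mean_lin tame_delayed)
qed

lemma trans_op_mono:
  assumes "Bseq F" "Bseq G" "\<And>k. F k \<le> G k"
  shows "trans_op F k \<le> trans_op G k"
  unfolding trans_op_def
  using assms clock_mono[of F G _ False] by (intro gamma_mean_mono tame_delayed) (auto simp: clock_def)

lemma trans_op_const: "trans_op (\<lambda>_. c) k = c"
  by (simp add: trans_op_def delayed_const[abs_def] gamma_mean_const)

lemma trans_op_bounds:
  assumes "\<And>k. a \<le> F k \<and> F k \<le> b"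
  shows "a \<le> trans_op F k \<and> trans_op F k \<le> b"
proof -
  have "Bseq F"
  proof (rule BseqI')
    show "norm (F k) \<le> max \<bar>a\<bar> \<bar>b\<bar>" for k
      using assms[of k] by auto
  qed
  then show ?thesis
    using trans_op_mono[of F "\<lambda>_. b" k] trans_op_mono[of "\<lambda>_. a" F k] assms
    by (auto simp: trans_op_const Bfun_const)
qed

lemma Bseq_trans_op:
  assumes "Bseq F"
  shows "Bseq (trans_op F)"
proof -
  obtain C where C: "\<And>k. - C \<le> F k \<and> F k \<le> C"
    using assms by (auto simp: Bseq_def abs_le_iff) (metis minus_le_iff)
  show ?thesis
    using trans_op_bounds[of "- C" F C] C
    by (intro BseqI'[of _ C]) (auto simp: abs_le_iff minus_le_iff)
qed

lemma Bseq_funpow_trans_op: "Bseq F \<Longrightarrow> Bseq ((trans_op ^^ n) F)"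
  by (induction n) (auto intro: Bseq_trans_op)

lemma funpow_trans_op_lin:
  assumes "Bseq F" "Bseq G"
  shows "(trans_op ^^ n) (\<lambda>k. a * F k + b * G k) =
    (\<lambda>k. a * (trans_op ^^ n) F k + b * (trans_op ^^ n) G k)"
  by (induction n) (simp_all add: trans_op_lin Bseq_funpow_trans_op assms)

text \<open>Forcing the first ring at once can only help an increasing \<open>F\<close>. The gap
  \<open>?D\<close> has derivative \<open>\<delta> * ?d - ?D\<close> with \<open>?d\<close>
  nonnegative, so \<open>exp t * ?D t\<close> increases from a nonnegative value.\<close>

lemma delayed_le_poisson_Suc:
  assumes "Bseq F" "incseq F" "0 \<le> t"
  shows "delayed F t \<le> poisson (\<lambda>j. F (Suc j)) t"
proof -
  let ?D = "\<lambda>t. poisson (\<lambda>j. F (Suc j)) t - delayed F t"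
  let ?d = "\<lambda>t. poisson (\<lambda>j. F (Suc (Suc j))) t - poisson (\<lambda>j. F (Suc j)) t"
  have "exp 0 * ?D 0 \<le> exp t * ?D t"
  proof (rule DERIV_nonneg_imp_nondecreasing[OF assms(3)])
    fix x assume x: "0 \<le> x" "x \<le> t"
    have "((\<lambda>t. exp t * ?D t) has_real_derivative exp x * (\<delta> * ?d x)) (at x)"
      by (rule derivative_eq_intros has_derivative_delayed has_derivative_poisson Bseq_Suc assms(1) refl)+
         (simp add: algebra_simps)
    moreover have "poisson (\<lambda>j. F (Suc j)) x \<le> poisson (\<lambda>j. F (Suc (Suc j))) x"
      using clock_mono[of "\<lambda>j. F (Suc j)" "\<lambda>j. F (Suc (Suc j))" x True] assms x
      by (auto simp: clock_def Bseq_Suc incseq_SucD Bseq_Suc[OF Bseq_Suc])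
    ultimately show "\<exists>y. ((\<lambda>t. exp t * ?D t) has_real_derivative y) (at x) \<and> 0 \<le> y"
      using delta_pos by (intro exI[of _ "exp x * (\<delta> * ?d x)"]) auto
  qed
  moreover have "0 \<le> ?D 0"
    using assms(2) by (simp add: poisson_0 delayed_0 incseq_SucD)
  ultimately have "0 \<le> exp t * ?D t"
    by simp
  then show ?thesis
    by (simp add: zero_le_mult_iff)
qed

text \<open>By parts, the increment in \<open>k\<close> is a Gamma mean of the derivative of
  \<open>delayed F\<close>, up to the factor \<open>\<delta>\<close>. Monotonicity later reduces an
  inequality for all positive \<open>k\<close> to \<open>k = 1\<close>.\<close>

lemma incseq_trans_op:
  assumes "Bseq F" "incseq F"
  shows "incseq (trans_op F)"
proof (rule incseq_SucI)
  fix k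
  let ?H = "\<lambda>t. poisson (\<lambda>j. F (Suc j)) t - delayed F t"
  have t: "tame ?H"
    using tame_lin[OF tame_poisson[OF Bseq_Suc[OF assms(1)]] tame_delayed[OF assms(1)], of 1 "- 1"] by simp
  have "gamma_mean (Suc k) ?H = \<delta> * (gamma_mean (Suc k) (delayed F) - gamma_mean k (delayed F))"
    by (rule gamma_mean_deriv[OF tame_delayed[OF assms(1)] t has_derivative_delayed[OF assms(1)]])
  moreover have "0 \<le> gamma_mean (Suc k) ?H"
    using gamma_mean_mono[OF tame_const[of 0] t, of "Suc k"] delayed_le_poisson_Suc[OF assms] by (simp add: gamma_mean_const)
  ultimately show "trans_op F k \<le> trans_op F (Suc k)"
    using delta_pos by (simp add: trans_op_def zero_le_mult_iff)
qed

definition alive :: "nat \<Rightarrow> real" where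
  "alive k = (if k = 0 then 0 else 1)"

text \<open>The functions \<open>geo i\<close> span a space that \<open>trans_op\<close> leaves invariant.\<close>

definition geo :: "nat \<Rightarrow> nat \<Rightarrow> real" where
  "geo i k = 1 - ((\<delta> + i) / (1 + \<delta> + i)) ^ k"

lemma Bseq_alive: "Bseq alive"
  by (rule BseqI'[of _ 1]) (simp add: alive_def)

lemma Bseq_geo: "Bseq (geo i)"
proof (rule Bseq_unit)
  fix k
  have "((\<delta> + i) / (1 + \<delta> + i)) ^ k \<le> 1"
    using delta_pos by (intro power_le_one) (auto simp: field_simps)
  then show "0 \<le> geo i k \<and> geo i k \<le> 1"
    using delta_pos by (simp add: geo_def)
qed

lemma trans_op_alive: "trans_op alive = geo 0"
proof
  fix k
  have "delayed alive t = 1 * 1 + (- 1) * exp (- (1 * t))" for t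
    by (rule delayed_unique[symmetric, OF Bseq_alive])
       (auto simp: alive_def poisson_const intro!: derivative_eq_intros)
  then have "delayed alive = (\<lambda>t. 1 * 1 + (- 1) * exp (- (1 * t)))"
    by (intro ext)
  then have "trans_op alive k = 1 * 1 + (- 1) * (\<delta> / (\<delta> + 1)) ^ k"
    unfolding trans_op_def
    by (simp only: gamma_mean_lin[OF tame_const tame_exp[of 1]] gamma_mean_const gamma_mean_exp zero_le_one)
  then show "trans_op alive k = geo 0 k"
    by (simp add: geo_def add.commute)
qed

text \<open>On \<open>r ^ k\<close> the clock produces exponentials of rates 1 and
  \<open>\<delta> * (1 - r)\<close>, whose Gamma means are powers of
  \<open>\<delta> / (1 + \<delta>)\<close> and of \<open>1 / (2 - r)\<close>. The ratios in
  \<open>geo\<close> are the orbit of \<open>\<delta> / (1 + \<delta>)\<close> under the map from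
  \<open>r\<close> to \<open>1 / (2 - r)\<close>.\<close>

lemma trans_op_geo:
  "trans_op (geo i) = (\<lambda>k. (1 - \<delta>) / (1 + i) * geo 0 k + (\<delta> + i) / (1 + i) * geo (Suc i) k)"
proof
  fix k
  define z where "z = 1 + \<delta> + i"
  have z: "z > 0"
    using delta_pos by (simp add: z_def)
  \<comment> \<open>\<open>b\<close> matches the exponential of rate \<open>\<delta> / z\<close> in
    the equation for \<open>delayed\<close>, and \<open>a\<close> makes the constants add up to 1.
    There is no resonance, because \<open>1 - \<delta> / z = (1 + i) / z\<close> is not 0.\<close>
  define a where "a = (1 - \<delta>) / (1 + i)"
  define b where "b = (\<delta> + i) / (1 + i)"
  have ab: "a = 1 - b"
    by (simp add: a_def b_def field_simps)
  have bz: "b * (1 - \<delta> / z) = (\<delta> + i) / z"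
  proof -
    have "1 - \<delta> / z = (1 + i) / z"
      using z by (simp add: field_simps) (simp add: z_def)
    then show ?thesis
      by (simp add: b_def)
  qed
  have "delayed (geo i) t = a * (1 + (- 1) * exp (- (1 * t))) + b * (1 + (- 1) * exp (- (\<delta> / z * t)))" for t
  proof (rule delayed_unique[symmetric, OF Bseq_geo])
    fix t
    have "Bseq (\<lambda>j. ((\<delta> + i) / z) ^ j)"
      using delta_pos by (intro Bseq_unit) (auto simp: z_def intro!: power_le_one)
    then have "poisson (\<lambda>j. 1 * 1 + (- ((\<delta> + i) / z)) * ((\<delta> + i) / z) ^ j) t =
        1 * 1 + (- ((\<delta> + i) / z)) * exp (- (\<delta> * (1 - (\<delta> + i) / z) * t))"
      by (subst poisson_lin) (auto simp: Bfun_const poisson_const poisson_geometric)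
    then have P: "poisson (\<lambda>j. geo i (Suc j)) t = 1 - (\<delta> + i) / z * exp (- (\<delta> * (1 - (\<delta> + i) / z) * t))"
      by (simp add: geo_def z_def)
    have "1 - (\<delta> + i) / z = 1 / z"
      using z by (simp add: field_simps) (simp add: z_def)
    then have P: "poisson (\<lambda>j. geo i (Suc j)) t = 1 - b * (1 - \<delta> / z) * exp (- (\<delta> / z * t))"
      using P bz by simp
    show "((\<lambda>t. a * (1 + (- 1) * exp (- (1 * t))) + b * (1 + (- 1) * exp (- (\<delta> / z * t))))
        has_real_derivative
        poisson (\<lambda>j. geo i (Suc j)) t -
        (a * (1 + (- 1) * exp (- (1 * t))) + b * (1 + (- 1) * exp (- (\<delta> / z * t))))) (at t)"
      unfolding P
      by (rule derivative_eq_intros refl)+ (simp add: ab algebra_simps)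
  qed (simp add: geo_def)
  then have "delayed (geo i) = (\<lambda>t. a * (1 * 1 + (- 1) * exp (- (1 * t))) + b * (1 * 1 + (- 1) * exp (- (\<delta> / z * t))))"
    by (intro ext) simp
  then have "trans_op (geo i) k =
      a * (1 * 1 + (- 1) * (\<delta> / (\<delta> + 1)) ^ k) + b * (1 * 1 + (- 1) * (\<delta> / (\<delta> + \<delta> / z)) ^ k)"
    unfolding trans_op_def
    using z delta_pos tame_exp[of 1] tame_exp[of "\<delta> / z"]
    by (simp only: gamma_mean_lin[OF tame_lin[OF tame_const tame_exp] tame_lin[OF tame_const tame_exp]]
        gamma_mean_lin[OF tame_const tame_exp] gamma_mean_const gamma_mean_exp zero_le_one divide_nonneg_nonneg less_imp_le)
  moreover have "\<delta> / (\<delta> + \<delta> / z) = (\<delta> + Suc i) / (1 + \<delta> + Suc i)"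
  proof -
    have "\<delta> + \<delta> / z = \<delta> * ((z + 1) / z)"
      using z by (simp add: field_simps)
    then show ?thesis
      using z delta_pos by (simp add: z_def add_ac)
  qed
  ultimately show "trans_op (geo i) k =
      (1 - \<delta>) / (1 + i) * geo 0 k + (\<delta> + i) / (1 + i) * geo (Suc i) k"
    by (simp add: geo_def a_def b_def add.commute)
qed

text \<open>All \<open>i\<close> are needed at once, since one application of
  \<open>trans_op\<close> yields both \<open>geo 0\<close> and \<open>geo (Suc i)\<close>. As
  \<open>i\<close> enters only the last factor, the induction step is an identity of rational
  functions.\<close>

lemma funpow_trans_op_geo:
  "(trans_op ^^ n) (geo i) 1 = (\<Prod>j=1..n. real j / (real j + \<delta>)) * ((n + 1) / (1 + \<delta> + i + n))"
proof (induction n arbitrary: i)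
  case 0
  then show ?case
    using delta_pos by (simp add: geo_def field_simps)
next
  case (Suc n)
  define p where "p = (\<Prod>j=1..n. real j / (real j + \<delta>))"
  have "(trans_op ^^ Suc n) (geo i) 1 = (trans_op ^^ n) (trans_op (geo i)) 1"
    by (simp add: funpow_swap1)
  also have "\<dots> = (1 - \<delta>) / (1 + i) * (trans_op ^^ n) (geo 0) 1 + (\<delta> + i) / (1 + i) * (trans_op ^^ n) (geo (Suc i)) 1"
    by (simp only: trans_op_geo funpow_trans_op_lin[OF Bseq_geo Bseq_geo])
  also have "\<dots> = (1 - \<delta>) / (1 + i) * (p * ((n + 1) / (1 + \<delta> + n))) +
      (\<delta> + i) / (1 + i) * (p * ((n + 1) / (2 + \<delta> + i + n)))"
    by (simp only: Suc.IH p_def) (simp add: add_ac)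
  also have "\<dots> = p * (n + 1) * ((1 - \<delta>) / (1 + i) * (1 / (1 + \<delta> + n)) + (\<delta> + i) / (1 + i) * (1 / (2 + \<delta> + i + n)))"
    by (simp add: algebra_simps)
  also have "(1 - \<delta>) / (1 + i) * (1 / (1 + \<delta> + n)) + (\<delta> + i) / (1 + i) * (1 / (2 + \<delta> + i + n)) =
      (n + 2) / ((n + 1 + \<delta>) * (2 + \<delta> + i + n))"
  proof -
    have nz: "1 + real i \<noteq> 0" "1 + \<delta> + real n \<noteq> 0" "2 + \<delta> + real i + real n \<noteq> 0"
      using delta_pos by linarith+
    have "(1 - \<delta>) * (2 + \<delta> + i + n) + (\<delta> + i) * (1 + \<delta> + n) = (1 + real i) * (n + 2)"
      by (simp add: algebra_simps)
    then show ?thesis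
      using nz by (simp add: divide_simps)
  qed
  also have "p * (n + 1) * \<dots> = (\<Prod>j=1..Suc n. real j / (real j + \<delta>)) * ((real (Suc n) + 1) / (1 + \<delta> + i + Suc n))"
  proof -
    have pe: "(\<Prod>j=1..Suc n. real j / (real j + \<delta>)) = p * ((real n + 1) / (real n + 1 + \<delta>))"
      by (simp add: p_def add_ac)
    show ?thesis
      unfolding pe by (simp add: add_ac)
  qed
  finally show ?case .
qed

lemma funpow_trans_op_alive: "(trans_op ^^ n) alive 1 = (\<Prod>j=1..n. real j / (real j + \<delta>))"
proof (cases n)
  case 0
  then show ?thesis
    by (simp add: alive_def)
next
  case (Suc k)
  have "(trans_op ^^ n) alive 1 = (trans_op ^^ k) (geo 0) 1"
    by (simp add: Suc funpow_swap1 trans_op_alive)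
  also have "\<dots> = (\<Prod>j=1..n. real j / (real j + \<delta>))"
    unfolding funpow_trans_op_geo using delta_pos by (simp add: Suc add_ac)
  finally show ?thesis .
qed

text \<open>Consecutive terms have ratio \<open>m * (n + 1) / (n + 1 + \<delta>)\<close>, which
  tends to \<open>m\<close> and so eventually stays above a fixed \<open>r > 1\<close>.\<close>

lemma survival_subexponential:
  assumes "1 < m"
  shows "\<exists>n\<ge>1. 1 \<le> m ^ n * (\<Prod>j=1..n. real j / (real j + \<delta>))"
proof -
  define q where "q n = m ^ n * (\<Prod>j=1..n. real j / (real j + \<delta>))" for n :: nat
  have q_pos: "0 < q n" for n
    using assms delta_pos by (auto simp: q_def intro!: mult_pos_pos prod_pos add_pos_pos)
  define r where "r = (1 + m) / 2"
  have r: "1 < r" "r < m"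
    using assms by (auto simp: r_def)
  obtain N where N: "r * \<delta> / (m - r) \<le> real N"
    using real_arch_simple by blast
  have step: "r * q n \<le> q (Suc n)" if "N \<le> n" for n
  proof -
    have "r * \<delta> \<le> (m - r) * (n + 1)"
    proof -
      have "r * \<delta> \<le> (m - r) * N"
        using N r by (simp add: pos_divide_le_eq mult.commute)
      also have "\<dots> \<le> (m - r) * (n + 1)"
        using that r by (intro mult_left_mono) auto
      finally show ?thesis .
    qed
    then have "r \<le> m * ((n + 1) / (n + 1 + \<delta>))"
      using delta_pos by (simp add: field_simps)
    then have "q n * r \<le> q n * (m * ((n + 1) / (n + 1 + \<delta>)))"
      using q_pos[of n] by (intro mult_left_mono) auto
    then show ?thesis
      by (simp add: q_def mult_ac add_ac)
  qed
  have growth: "q N * r ^ j \<le> q (N + j)" for j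
  proof (induction j)
    case (Suc j)
    have "q N * r ^ Suc j \<le> r * q (N + j)"
      using Suc r by simp
    also have "\<dots> \<le> q (N + Suc j)"
      using step[of "N + j"] by simp
    finally show ?case .
  qed simp
  obtain j where j: "1 / q N < r ^ j"
    using real_arch_pow[OF r(1)] by blast
  \<comment> \<open>The exponent \<open>Suc j\<close> ensures that the final index
    \<open>N + Suc j\<close> is at least 1.\<close>
  have "1 / q N < r ^ Suc j"
    by (rule order.strict_trans2[OF j power_increasing]) (use r in auto)
  then have "1 \<le> q N * r ^ Suc j"
    using q_pos[of N] by (simp add: field_simps)
  also have "\<dots> \<le> q (N + Suc j)"
    by (rule growth)
  finally show ?thesis
    by (intro exI[of _ "N + Suc j"]) (simp add: q_def)
qed

text \<open>The witness is a truncated Green function: \<open>G n\<close> sums \<open>m ^ j\<close>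
  times the \<open>j\<close>-th iterate of \<open>alive\<close> over \<open>j < n\<close>, and
  \<open>m * trans_op\<close> telescopes it to \<open>G n - alive + m ^ n * f n\<close>. The
  remainder is nonnegative once \<open>m ^ n\<close> times the survival probability from state 1 is
  at least 1.\<close>

lemma exists_supercritical_function:
  assumes "1 < m"
  shows "\<exists>g. Bseq g \<and> (\<forall>k. 0 \<le> g k) \<and> g 0 = 0 \<and> 0 < g 1 \<and> (\<forall>k. g k \<le> m * trans_op g k)"
proof -
  obtain n where n: "1 \<le> n" "1 \<le> m ^ n * (\<Prod>j=1..n. real j / (real j + \<delta>))"
    using survival_subexponential[OF assms] by blast
  define f where "f j = (trans_op ^^ j) alive" for j
  have B: "Bseq (f j)" for j
    by (simp add: f_def Bseq_funpow_trans_op Bseq_alive)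
  have f01: "0 \<le> f j k \<and> f j k \<le> 1" for j k
  proof (induction j arbitrary: k)
    case (Suc j)
    then show ?case
      using trans_op_bounds[of 0 "f j" 1 k] by (simp add: f_def)
  qed (simp add: f_def alive_def)
  have f0: "f j 0 = 0" for j
    by (induction j) (simp_all add: f_def alive_def trans_op_0)
  have inc: "incseq (f j)" for j
  proof (induction j)
    case 0
    show ?case
      by (rule incseq_SucI) (simp add: f_def alive_def)
  next
    case (Suc j)
    then show ?case
      using incseq_trans_op[OF B] by (simp add: f_def)
  qed
  \<comment> \<open>The choice of \<open>n\<close> settles \<open>k = 1\<close>; the iterates
    increase in \<open>k\<close>, which covers all positive \<open>k\<close>, and both sides vanish
    at 0.\<close>
  have key: "f 0 k \<le> m ^ n * f n k" for k
  proof (cases "k = 0")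
    case False
    then have "f n 1 \<le> f n k"
      using inc[of n] by (simp add: incseq_def)
    then have "m ^ n * f n 1 \<le> m ^ n * f n k"
      using assms by (intro mult_left_mono) auto
    then show ?thesis
      using n(2) f01[of 0 k] unfolding f_def funpow_trans_op_alive by linarith
  qed (simp add: f0)
  define G where "G n k = (\<Sum>j<n. m ^ j * f j k)" for n k
  have BG: "Bseq (G n)" for n
  proof (induction n)
    case (Suc n)
    have "Bseq (\<lambda>k. 1 * G n k + m ^ n * f n k)"
      by (intro Bseq_lin Suc B)
    then show ?case
      by (simp add: G_def[abs_def])
  qed (simp add: G_def[abs_def] Bfun_const)
  have tel: "m * trans_op (G n) k = G n k - f 0 k + m ^ n * f n k" for n k
  proof (induction n)
    case 0
    then show ?case
      using trans_op_const[of 0 k] by (simp add: G_def[abs_def])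
  next
    case (Suc n)
    have "G (Suc n) = (\<lambda>k. 1 * G n k + m ^ n * f n k)"
      by (simp add: G_def[abs_def])
    then have "trans_op (G (Suc n)) k = trans_op (G n) k + m ^ n * f (Suc n) k"
      by (simp only: trans_op_lin[OF BG B]) (simp add: f_def)
    then have "m * trans_op (G (Suc n)) k = m * trans_op (G n) k + m ^ Suc n * f (Suc n) k"
      by (simp add: algebra_simps)
    also have "\<dots> = G (Suc n) k - f 0 k + m ^ Suc n * f (Suc n) k"
      by (simp add: Suc) (simp add: G_def)
    finally show ?case .
  qed
  show ?thesis
  proof (intro exI[of _ "G n"] conjI allI BG)
    show "0 \<le> G n k" for k
      unfolding G_def using assms f01 by (intro sum_nonneg mult_nonneg_nonneg) auto
    show "G n 0 = 0"
      by (simp add: G_def f0)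
    have "m ^ 0 * f 0 1 \<le> G n 1"
      unfolding G_def using assms f01 n by (intro member_le_sum) auto
    then show "0 < G n 1"
      by (simp add: f_def alive_def)
    show "G n k \<le> m * trans_op (G n) k" for k
      using tel[of n k] key[of k] by linarith
  qed
qed

end

subsection \<open>The walk and its clocks\<close>

text \<open>A walk at or below \<open>v\<close> has yet to cross the edge above \<open>v\<close>
  upwards to end its visit. The ring that started the visit is already spent, so this crossing is
  added to the future rings of the clock at the parent.\<close>

definition entering :: "vertex \<Rightarrow> vertex \<Rightarrow> nat" where
  "entering x v = (if prefix v x then 1 else 0)"

lemma not_prefix_butlast:
  assumes "x \<noteq> []"
  shows "\<not> prefix (x @ w) (butlast x)"
proof
  assume "prefix (x @ w) (butlast x)"
  moreover have "0 < length x"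
    using assms by simp
  moreover have "length x + length w \<le> length x - 1"
    using prefix_length_le[OF \<open>prefix (x @ w) (butlast x)\<close>]
    by (simp only: length_append length_butlast)
  ultimately show False
    by linarith
qed

context orrw
begin

text \<open>A race between the clock of the parent edge and those of the children. The winner either
  lowers \<open>k\<close> or shifts the count of one child and marks its edge as traversed. The
  product rule produces the terms of the second kind, \<open>gamma_mean_deriv\<close> that of the
  first.\<close>

lemma gamma_mean_race:
  assumes I: "finite I" and B: "\<And>i. i \<in> I \<Longrightarrow> Bseq (f i)"
  shows "(\<delta> + (\<Sum>i\<in>I. rate (b i))) * gamma_mean (Suc k) (\<lambda>t. \<Prod>i\<in>I. clock (b i) (f i) t) =
    \<delta> * gamma_mean k (\<lambda>t. \<Prod>i\<in>I. clock (b i) (f i) t) +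
    (\<Sum>i\<in>I. rate (b i) * gamma_mean (Suc k)
       (\<lambda>t. \<Prod>j\<in>I. clock (j = i \<or> b j) (if j = i then (\<lambda>n. f i (Suc n)) else f j) t))"
proof -
  define G where "G t = (\<Prod>i\<in>I. clock (b i) (f i) t)" for t
  define P where "P i t = (\<Prod>j\<in>I. clock (j = i \<or> b j) (if j = i then (\<lambda>n. f i (Suc n)) else f j) t)" for i t
  define H where "H t = (\<Sum>i\<in>I. rate (b i) * P i t + (- rate (b i)) * G t)" for t
  have tG: "tame G"
    unfolding G_def using B by (intro tame_prod tame_clock)
  have tP: "tame (P i)" if "i \<in> I" for i
    unfolding P_def using B that by (intro tame_prod tame_clock) (auto intro: Bseq_Suc)
  have tH: "tame H"
    unfolding H_def using tG tP by (intro tame_sum tame_lin)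
  have "(G has_real_derivative H t) (at t)" for t
  proof -
    have "(G has_real_derivative
        (\<Sum>i\<in>I. rate (b i) * (poisson (\<lambda>n. f i (Suc n)) t - clock (b i) (f i) t) * (\<Prod>j\<in>I - {i}. clock (b j) (f j) t))) (at t)"
      unfolding G_def[abs_def] using B by (intro has_field_derivative_prod has_derivative_clock)
    also have "(\<Sum>i\<in>I. rate (b i) * (poisson (\<lambda>n. f i (Suc n)) t - clock (b i) (f i) t) * (\<Prod>j\<in>I - {i}. clock (b j) (f j) t)) = H t"
      unfolding H_def
    proof (rule sum.cong[OF refl])
      fix i assume i: "i \<in> I"
      have "G t = clock (b i) (f i) t * (\<Prod>j\<in>I - {i}. clock (b j) (f j) t)"
        unfolding G_def by (rule prod.remove[OF I i])
      moreover have "P i t = poisson (\<lambda>n. f i (Suc n)) t * (\<Prod>j\<in>I - {i}. clock (b j) (f j) t)"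
        unfolding P_def by (subst prod.remove[OF I i]) (auto simp: clock_def intro!: prod.cong)
      ultimately show "rate (b i) * (poisson (\<lambda>n. f i (Suc n)) t - clock (b i) (f i) t) * (\<Prod>j\<in>I - {i}. clock (b j) (f j) t) =
          rate (b i) * P i t + (- rate (b i)) * G t"
        by (simp add: algebra_simps)
    qed
    finally show ?thesis .
  qed
  then have "gamma_mean (Suc k) H = \<delta> * (gamma_mean (Suc k) G - gamma_mean k G)"
    by (rule gamma_mean_deriv[OF tG tH])
  moreover have "gamma_mean (Suc k) H = (\<Sum>i\<in>I. rate (b i) * gamma_mean (Suc k) (P i) + (- rate (b i)) * gamma_mean (Suc k) G)"
  proof -
    have "gamma_mean (Suc k) H = (\<Sum>i\<in>I. gamma_mean (Suc k) (\<lambda>t. rate (b i) * P i t + (- rate (b i)) * G t))"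
      unfolding H_def[abs_def] by (intro gamma_mean_sum tame_lin tP tG)
    also have "\<dots> = (\<Sum>i\<in>I. rate (b i) * gamma_mean (Suc k) (P i) + (- rate (b i)) * gamma_mean (Suc k) G)"
      by (intro sum.cong refl gamma_mean_lin tP tG)
    finally show ?thesis .
  qed
  moreover have "\<dots> = (\<Sum>i\<in>I. rate (b i) * gamma_mean (Suc k) (P i)) - (\<Sum>i\<in>I. rate (b i)) * gamma_mean (Suc k) G"
    by (simp add: sum_subtractf sum_distrib_right)
  ultimately have "(\<delta> + (\<Sum>i\<in>I. rate (b i))) * gamma_mean (Suc k) G =
      \<delta> * gamma_mean k G + (\<Sum>i\<in>I. rate (b i) * gamma_mean (Suc k) (P i))"
    by (simp add: algebra_simps)
  then show ?thesis
    by (simp add: G_def[abs_def] P_def[abs_def])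
qed

text \<open>The probability that \<open>v\<close> has been left \<open>k\<close> times towards its parent before the walk gets \<open>d\<close>
  levels below \<open>v\<close> through children with index less than \<open>B\<close>. Here \<open>x\<close> is the position of the
  walk, \<open>V\<close> is the set of the lower endpoints of the traversed edges, and \<open>k\<close> includes the crossing
  that ends the visit in progress when \<open>x\<close> lies below \<open>v\<close>; \<open>entering\<close> accounts for it at the children.\<close>

primrec no_escape :: "nat \<Rightarrow> nat \<Rightarrow> vertex set \<Rightarrow> vertex set \<Rightarrow> vertex \<Rightarrow> vertex \<Rightarrow> nat \<Rightarrow> real" where
  "no_escape 0 B T V x v k = (if k = 0 then 1 else 0)"
| "no_escape (Suc d) B T V x v k =
     gamma_mean k (\<lambda>t. \<Prod>i | i < B \<and> v @ [i] \<in> T.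
       clock (v @ [i] \<in> V) (\<lambda>j. no_escape d B T V x (v @ [i]) (j + entering x (v @ [i]))) t)"

lemma no_escape_unit: "0 \<le> no_escape d B T V x v k \<and> no_escape d B T V x v k \<le> 1"
proof (induction d arbitrary: v k)
  case (Suc d)
  then show ?case
    unfolding no_escape.simps
    by (intro conjI gamma_mean_unit tame_prod tame_clock Bseq_unit prod_nonneg prod_le_1) (auto simp: clock_unit)
qed simp

lemma Bseq_no_escape: "Bseq (\<lambda>j. no_escape d B T V x v (j + c))"
  by (intro Bseq_unit no_escape_unit)

text \<open>Only the state strictly below \<open>v\<close> enters, hence
  \<open>w \<noteq> []\<close>: the edge above \<open>v\<close> and a position at \<open>v\<close>
  itself act through \<open>k\<close> alone. This locality shows that steps elsewhere change nothing
  and that only finitely many words of the tree matter.\<close>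

lemma no_escape_cong:
  assumes "\<And>w. w \<noteq> [] \<Longrightarrow> v @ w \<in> V \<longleftrightarrow> v @ w \<in> V'"
    and "\<And>w. w \<noteq> [] \<Longrightarrow> prefix (v @ w) x \<longleftrightarrow> prefix (v @ w) x'"
    and "\<And>w. w \<noteq> [] \<Longrightarrow> length w \<le> d \<Longrightarrow> set w \<subseteq> {..<B} \<Longrightarrow> v @ w \<in> T \<longleftrightarrow> v @ w \<in> T'"
  shows "no_escape d B T V x v k = no_escape d B T' V' x' v k"
  using assms
proof (induction d arbitrary: v k)
  case (Suc d)
  have "no_escape d B T V x (v @ [i]) j = no_escape d B T' V' x' (v @ [i]) j" if "i < B" for i j
  proof (rule Suc.IH)
    fix w :: vertex assume "w \<noteq> []" "length w \<le> d" "set w \<subseteq> {..<B}"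
    then show "(v @ [i]) @ w \<in> T \<longleftrightarrow> (v @ [i]) @ w \<in> T'"
      using Suc.prems(3)[of "i # w"] that by simp
  qed (use Suc.prems(1,2)[of "i # w" for w] in simp_all)
  moreover have "entering x (v @ [i]) = entering x' (v @ [i])" "v @ [i] \<in> V \<longleftrightarrow> v @ [i] \<in> V'" for i
    using Suc.prems(1,2)[of "[i]"] by (simp_all add: entering_def)
  moreover have "{i. i < B \<and> v @ [i] \<in> T} = {i. i < B \<and> v @ [i] \<in> T'}"
    using Suc.prems(3)[of "[i]" for i] by auto
  ultimately show ?case
    unfolding no_escape.simps by (auto intro!: arg_cong[where f = "gamma_mean k"] ext prod.cong)
qed simp

lemma no_escape_zero: "(\<And>w. w \<noteq> [] \<Longrightarrow> \<not> prefix (v @ w) x) \<Longrightarrow> no_escape d B T V x v 0 = 1"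
proof (induction d arbitrary: v)
  case (Suc d)
  have "no_escape d B T V x (v @ [i]) 0 = 1" for i
    using Suc.prems[of "i # w" for w] by (intro Suc.IH) simp
  moreover have "entering x (v @ [i]) = 0" for i
    using Suc.prems[of "[i]"] by (simp add: entering_def)
  ultimately show ?case
    by (simp add: gamma_mean_0 clock_0)
qed simp

lemma gamma_mean_mult_poisson_lin:
  assumes "tame R" "Bseq F" "Bseq G"
  shows "gamma_mean k (\<lambda>t. R t * poisson (\<lambda>j. a * F j + b * G j) t) =
    a * gamma_mean k (\<lambda>t. R t * poisson F t) + b * gamma_mean k (\<lambda>t. R t * poisson G t)"
proof -
  have "(\<lambda>t. R t * poisson (\<lambda>j. a * F j + b * G j) t) =
      (\<lambda>t. a * (R t * poisson F t) + b * (R t * poisson G t))"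
    using assms by (simp add: poisson_lin algebra_simps)
  then show ?thesis
    using assms by (simp only: gamma_mean_lin tame_mult tame_poisson)
qed

lemma Bseq_sum: "(\<And>i. i \<in> I \<Longrightarrow> Bseq (F i)) \<Longrightarrow> Bseq (\<lambda>j. \<Sum>i\<in>I. w i * F i j)"
  for F :: "'i \<Rightarrow> nat \<Rightarrow> real"
proof (induction I rule: infinite_finite_induct)
  case (insert i I)
  then have "Bseq (\<lambda>j. w i * F i j + 1 * (\<Sum>i\<in>I. w i * F i j))"
    by (intro Bseq_lin) auto
  then show ?case
    using insert by simp
qed (auto simp: Bfun_const)

lemma gamma_mean_mult_poisson_sum:
  assumes "tame R" "\<And>i. i \<in> I \<Longrightarrow> Bseq (F i)"
  shows "gamma_mean k (\<lambda>t. R t * poisson (\<lambda>j. \<Sum>i\<in>I. w i * F i j) t) = (\<Sum>i\<in>I. w i * gamma_mean k (\<lambda>t. R t * poisson (F i) t))"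
  using assms(2)
proof (induction I rule: infinite_finite_induct)
  case (insert i I)
  then have "gamma_mean k (\<lambda>t. R t * poisson (\<lambda>j. w i * F i j + 1 * (\<Sum>i\<in>I. w i * F i j)) t) =
      w i * gamma_mean k (\<lambda>t. R t * poisson (F i) t) + 1 * gamma_mean k (\<lambda>t. R t * poisson (\<lambda>j. \<Sum>i\<in>I. w i * F i j) t)"
    by (intro gamma_mean_mult_poisson_lin assms(1) Bseq_sum) auto
  then show ?case
    using insert by simp
qed (auto simp: poisson_const gamma_mean_const)

text \<open>By linearity the one-step equation at the position of the walk propagates to all its ancestors.\<close>

lemma no_escape_harmonic:
  assumes "x = v @ u" "length u < d" "x \<noteq> []" "finite {i. x @ [i] \<in> T}"
    and "\<And>w. prefix w x \<Longrightarrow> w \<in> T"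
    and "\<And>w. prefix w x \<Longrightarrow> w \<noteq> [] \<Longrightarrow> w \<in> V"
  shows "\<delta> * no_escape d B T V (butlast x) v (k + entering (butlast x) v) +
      (\<Sum>i | x @ [i] \<in> T. rate (x @ [i] \<in> V) * no_escape d B T (insert (x @ [i]) V) (x @ [i]) v (Suc k)) =
    (\<delta> + (\<Sum>i | x @ [i] \<in> T. rate (x @ [i] \<in> V))) * no_escape d B T V x v (Suc k)"
  using assms(1,2)
proof (induction u arbitrary: v d k)
  case Nil
  then obtain d' where d: "d = Suc d'" and x: "v = x"
    by (cases d) auto
  define C where "C = {i. x @ [i] \<in> T}"
  define I where "I = {i. i < B \<and> x @ [i] \<in> T}"
  have fin: "finite C" "finite I" "I \<subseteq> C"
    using assms(4) by (auto simp: C_def I_def)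
  define b where "b i \<longleftrightarrow> x @ [i] \<in> V" for i
  define f where "f i j = no_escape d' B T V x (x @ [i]) j" for i j
  have ins0: "entering x (x @ [i]) = 0" "entering (butlast x) (x @ [i]) = 0" "entering (butlast x) x = 0" for i
    using assms(3) not_prefix_butlast[of x "[]"] not_prefix_butlast[of x "[i]"] by (auto simp: entering_def)
  have stay: "no_escape d B T V x x k = gamma_mean k (\<lambda>t. \<Prod>i\<in>I. clock (b i) (f i) t)" for k
    by (simp add: d ins0 I_def b_def f_def[abs_def])
  have up: "no_escape d B T V (butlast x) x k = no_escape d B T V x x k" for k
  proof (rule no_escape_cong)
    fix w :: vertex assume "w \<noteq> []"
    then show "prefix (x @ w) (butlast x) = prefix (x @ w) x"
      using not_prefix_butlast[OF assms(3)] by auto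
  qed auto
  have sub: "no_escape d' B T (insert (x @ [i]) V) (x @ [i]) (x @ [j]) n = f j n" for i j n
    unfolding f_def
  proof (rule no_escape_cong)
    fix w :: vertex assume "w \<noteq> []"
    then show "prefix ((x @ [j]) @ w) (x @ [i]) = prefix ((x @ [j]) @ w) x"
      using prefix_length_le[of "(x @ [j]) @ w" "x @ [i]"] prefix_length_le[of "(x @ [j]) @ w" x]
      by auto
  qed auto
  have down: "no_escape d B T (insert (x @ [i]) V) (x @ [i]) x (Suc k) =
      gamma_mean (Suc k) (\<lambda>t. \<Prod>j\<in>I. clock (j = i \<or> b j) (if j = i then (\<lambda>n. f i (Suc n)) else f j) t)" for i
  proof -
    have "entering (x @ [i]) (x @ [j]) = (if j = i then 1 else 0)" for j
      by (simp add: entering_def)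
    then show ?thesis
      by (auto simp: d sub I_def[symmetric] b_def intro!: arg_cong[where f = "gamma_mean (Suc k)"] ext prod.cong)
  qed
  \<comment> \<open>A step to a child that is not counted, of index at least \<open>B\<close>,
    leaves the value unchanged, so its rate cancels from the equation.\<close>
  have out: "no_escape d B T (insert (x @ [i]) V) (x @ [i]) x (Suc k) = no_escape d B T V x x (Suc k)" if "i \<notin> I" for i
    unfolding stay down
    by (intro arg_cong[where f = "gamma_mean (Suc k)"] ext prod.cong refl) (use that in auto)
  have "(\<delta> + (\<Sum>i\<in>C. rate (b i))) * no_escape d B T V x x (Suc k) =
      (\<delta> + (\<Sum>i\<in>I. rate (b i))) * no_escape d B T V x x (Suc k) + (\<Sum>i\<in>C - I. rate (b i) * no_escape d B T V x x (Suc k))"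
    using sum.subset_diff[OF fin(3,1), of "\<lambda>i. rate (b i)"]
    by (simp add: algebra_simps sum_distrib_right)
  also have "(\<delta> + (\<Sum>i\<in>I. rate (b i))) * no_escape d B T V x x (Suc k) =
      \<delta> * no_escape d B T V x x k + (\<Sum>i\<in>I. rate (b i) * no_escape d B T (insert (x @ [i]) V) (x @ [i]) x (Suc k))"
    unfolding stay down by (rule gamma_mean_race) (auto simp: fin f_def[abs_def] intro: Bseq_no_escape[where c = 0, simplified])
  also have "(\<Sum>i\<in>C - I. rate (b i) * no_escape d B T V x x (Suc k)) =
      (\<Sum>i\<in>C - I. rate (b i) * no_escape d B T (insert (x @ [i]) V) (x @ [i]) x (Suc k))"
    by (simp add: out)
  finally have "(\<delta> + (\<Sum>i\<in>C. rate (b i))) * no_escape d B T V x x (Suc k) =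
      \<delta> * no_escape d B T V x x k + (\<Sum>i\<in>C. rate (b i) * no_escape d B T (insert (x @ [i]) V) (x @ [i]) x (Suc k))"
    using sum.subset_diff[OF fin(3,1), of "\<lambda>i. rate (b i) * no_escape d B T (insert (x @ [i]) V) (x @ [i]) x (Suc k)"]
    by simp
  then show ?case
    by (simp add: x up ins0 C_def b_def)
next
  case (Cons a u)
  then obtain d' where d: "d = Suc d'" and len: "length u < d'"
    by (cases d) auto
  define c where "c = v @ [a]"
  have x: "x = c @ u"
    using Cons.prems(1) by (simp add: c_def)
  define C where "C = {i. x @ [i] \<in> T}"
  define I where "I = {i. i < B \<and> v @ [i] \<in> T}"
  have fin: "finite C" "finite I"
    using assms(4) by (auto simp: C_def I_def)
  have cT: "c \<in> T" "c \<in> V"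
    using assms(5,6)[of c] by (auto simp: x c_def)
  have pv: "butlast x = v @ butlast (a # u)"
    by (simp add: Cons.prems(1) butlast_append)
  \<comment> \<open>\<open>x\<close> lies strictly below \<open>v\<close>, so
    \<open>butlast x\<close> is still in the subtree of \<open>v\<close>: the visit is not over and
    every term carries the same \<open>k + 1\<close>.\<close>
  have insv: "entering (butlast x) v = 1"
    by (simp add: entering_def pv)
  \<comment> \<open>\<open>R\<close> collects the children off the path to \<open>x\<close>, which
    the step does not affect. The factor of \<open>c\<close> is the only one that changes, and its
    clock is \<open>poisson\<close> because its edge has been traversed.\<close>
  define R where "R t = (\<Prod>i\<in>I - {a}. clock (v @ [i] \<in> V) (\<lambda>j. no_escape d' B T V x (v @ [i]) (j + entering x (v @ [i]))) t)" for t
  define F where "F V y j = no_escape d' B T V y c (j + entering y c)" for V y j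
  have tR: "tame R"
    unfolding R_def by (intro tame_prod tame_clock Bseq_no_escape)
  have BF: "Bseq (F V y)" for V y
    unfolding F_def[abs_def] by (rule Bseq_no_escape)
  have other: "clock (v @ [i] \<in> V') (\<lambda>j. no_escape d' B T V' y (v @ [i]) (j + entering y (v @ [i]))) =
      clock (v @ [i] \<in> V) (\<lambda>j. no_escape d' B T V x (v @ [i]) (j + entering x (v @ [i])))"
    if "i \<noteq> a" and y: "y = butlast x \<and> V' = V \<or> y = x \<and> V' = V \<or> (\<exists>i. y = x @ [i] \<and> V' = insert (x @ [i]) V)"
    for i y V'
  proof -
    have np: "\<not> prefix ((v @ [i]) @ w) y" "\<not> prefix ((v @ [i]) @ w) x" for w
    proof -
      show *: "\<not> prefix ((v @ [i]) @ w) x"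
        using \<open>i \<noteq> a\<close> by (auto simp: Cons.prems(1))
      have "\<not> prefix ((v @ [i]) @ w) (butlast x)"
        using * prefixeq_butlast[of x] prefix_order.trans by blast
      moreover have "\<not> prefix ((v @ [i]) @ w) (x @ [n])" for n
        using \<open>i \<noteq> a\<close> by (simp add: Cons.prems(1))
      ultimately show "\<not> prefix ((v @ [i]) @ w) y"
        using y * by metis
    qed
    moreover have "(v @ [i]) @ w \<in> V' \<longleftrightarrow> (v @ [i]) @ w \<in> V" for w
      using y \<open>i \<noteq> a\<close> by (auto simp: Cons.prems(1))
    ultimately have "no_escape d' B T V' y (v @ [i]) j = no_escape d' B T V x (v @ [i]) j" for j
      by (intro no_escape_cong) auto
    moreover have "entering y (v @ [i]) = entering x (v @ [i])"
      using np[of "[]"] by (simp add: entering_def)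
    moreover have "v @ [i] \<in> V' \<longleftrightarrow> v @ [i] \<in> V"
      using \<open>\<And>w. (v @ [i]) @ w \<in> V' \<longleftrightarrow> (v @ [i]) @ w \<in> V\<close>[of "[]"] by simp
    ultimately show ?thesis
      by simp
  qed
  show ?case
  proof (cases "a < B")
    case True
    then have a: "a \<in> I"
      using cT by (simp add: I_def c_def)
    have split: "no_escape d B T V' y v k = gamma_mean k (\<lambda>t. R t * poisson (F V' y) t)"
      if y: "y = butlast x \<and> V' = V \<or> y = x \<and> V' = V \<or> (\<exists>i. y = x @ [i] \<and> V' = insert (x @ [i]) V)"
      for y V' k
    proof -
      have "c \<in> V'"
        using y cT by auto
      then have "clock (v @ [a] \<in> V') (\<lambda>j. no_escape d' B T V' y (v @ [a]) (j + entering y (v @ [a]))) = poisson (F V' y)"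
        by (simp add: F_def[abs_def] c_def clock_def)
      then have "(\<Prod>i\<in>I. clock (v @ [i] \<in> V') (\<lambda>j. no_escape d' B T V' y (v @ [i]) (j + entering y (v @ [i]))) t) =
          R t * poisson (F V' y) t" for t
      proof -
        have "(\<Prod>i\<in>I - {a}. clock (v @ [i] \<in> V') (\<lambda>j. no_escape d' B T V' y (v @ [i]) (j + entering y (v @ [i]))) t) = R t"
          unfolding R_def
        proof (rule prod.cong[OF refl])
          fix i assume "i \<in> I - {a}"
          then have "i \<noteq> a"
            by simp
          show "clock (v @ [i] \<in> V') (\<lambda>j. no_escape d' B T V' y (v @ [i]) (j + entering y (v @ [i]))) t =
              clock (v @ [i] \<in> V) (\<lambda>j. no_escape d' B T V x (v @ [i]) (j + entering x (v @ [i]))) t"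
            by (rule fun_cong[OF other[OF \<open>i \<noteq> a\<close> y]])
        qed
        then show ?thesis
          unfolding prod.remove[OF fin(2) a] by (simp only: \<open>clock _ _ = poisson _\<close> mult.commute)
      qed
      then show ?thesis
        by (simp add: d I_def)
    qed
    \<comment> \<open>The crossing still pending at \<open>c\<close> supplies the \<open>Suc\<close>
      in the induction hypothesis.\<close>
    have ins: "F V x j = no_escape d' B T V x c (Suc j)"
      "F (insert (x @ [i]) V) (x @ [i]) j = no_escape d' B T (insert (x @ [i]) V) (x @ [i]) c (Suc j)" for i j
      by (simp_all add: F_def entering_def x)
    have IH: "\<delta> * F V (butlast x) j + (\<Sum>i\<in>C. rate (x @ [i] \<in> V) * F (insert (x @ [i]) V) (x @ [i]) j) =
        (\<delta> + (\<Sum>i\<in>C. rate (x @ [i] \<in> V))) * F V x j" for j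
      unfolding ins unfolding F_def C_def using Cons.IH[OF x len, of j] .
    define S where "S = (\<lambda>j. \<Sum>i\<in>C. rate (x @ [i] \<in> V) * F (insert (x @ [i]) V) (x @ [i]) j)"
    have BS: "Bseq S"
      unfolding S_def by (intro Bseq_sum BF)
    let ?w = "\<delta> + (\<Sum>i\<in>C. rate (x @ [i] \<in> V))"
    have "?w * gamma_mean (Suc k) (\<lambda>t. R t * poisson (F V x) t) = gamma_mean (Suc k) (\<lambda>t. R t * poisson (\<lambda>j. ?w * F V x j + 0 * F V x j) t)"
      by (subst gamma_mean_mult_poisson_lin[OF tR BF BF]) simp
    also have "(\<lambda>j. ?w * F V x j + 0 * F V x j) = (\<lambda>j. \<delta> * F V (butlast x) j + 1 * S j)"
      using IH by (auto simp: S_def)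
    also have "gamma_mean (Suc k) (\<lambda>t. R t * poisson (\<lambda>j. \<delta> * F V (butlast x) j + 1 * S j) t) =
        \<delta> * gamma_mean (Suc k) (\<lambda>t. R t * poisson (F V (butlast x)) t) + 1 * gamma_mean (Suc k) (\<lambda>t. R t * poisson S t)"
      by (rule gamma_mean_mult_poisson_lin[OF tR BF BS])
    also have "gamma_mean (Suc k) (\<lambda>t. R t * poisson S t) =
        (\<Sum>i\<in>C. rate (x @ [i] \<in> V) * gamma_mean (Suc k) (\<lambda>t. R t * poisson (F (insert (x @ [i]) V) (x @ [i])) t))"
      unfolding S_def by (rule gamma_mean_mult_poisson_sum[OF tR BF])
    finally have "\<delta> * gamma_mean (Suc k) (\<lambda>t. R t * poisson (F V (butlast x)) t) +
        (\<Sum>i\<in>C. rate (x @ [i] \<in> V) * gamma_mean (Suc k) (\<lambda>t. R t * poisson (F (insert (x @ [i]) V) (x @ [i])) t)) =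
        ?w * gamma_mean (Suc k) (\<lambda>t. R t * poisson (F V x) t)"
      by simp
    moreover have "no_escape d B T V (butlast x) v (Suc k) = gamma_mean (Suc k) (\<lambda>t. R t * poisson (F V (butlast x)) t)"
      by (rule split) blast
    moreover have "no_escape d B T V x v (Suc k) = gamma_mean (Suc k) (\<lambda>t. R t * poisson (F V x) t)"
      by (rule split) blast
    moreover have "no_escape d B T (insert (x @ [i]) V) (x @ [i]) v (Suc k) =
        gamma_mean (Suc k) (\<lambda>t. R t * poisson (F (insert (x @ [i]) V) (x @ [i])) t)" for i
      by (rule split) blast
    ultimately show ?thesis
      by (simp only: insv C_def Suc_eq_plus1)
  next
    case False
    \<comment> \<open>A branch of index at least \<open>B\<close> is not seen from \<open>v\<close>,
      so all terms coincide and the equation is trivial.\<close>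
    have same: "no_escape d B T V' y v k = no_escape d B T V x v k"
      if y: "y = butlast x \<and> V' = V \<or> y = x \<and> V' = V \<or> (\<exists>i. y = x @ [i] \<and> V' = insert (x @ [i]) V)"
      for y V' k
    proof -
      have "clock (v @ [i] \<in> V') (\<lambda>j. no_escape d' B T V' y (v @ [i]) (j + entering y (v @ [i]))) =
          clock (v @ [i] \<in> V) (\<lambda>j. no_escape d' B T V x (v @ [i]) (j + entering x (v @ [i])))"
        if "i < B" for i
        using that False by (intro other[OF _ y]) auto
      then show ?thesis
        by (simp add: d cong: conj_cong prod.cong_simp)
    qed
    have "no_escape d B T V (butlast x) v k = no_escape d B T V x v k"
      "no_escape d B T (insert (x @ [i]) V) (x @ [i]) v k = no_escape d B T V x v k" for i k
      by (rule same, blast)+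
    then show ?thesis
      by (simp add: insv distrib_right sum_distrib_right)
  qed
qed

end

subsection \<open>Averaging over the tree\<close>

lemma power_one_minus_le:
  fixes x :: real
  assumes "0 \<le> x" "x \<le> 1"
  shows "(1 - x) ^ a \<le> 1 - a * x + (a * x)\<^sup>2"
proof (induction a)
  case (Suc a)
  have "(1 - x) ^ Suc a \<le> (1 - x) * (1 - a * x + (a * x)\<^sup>2)"
    using Suc assms by (simp add: mult_left_mono)
  also have "\<dots> = 1 - Suc a * x + (Suc a * x)\<^sup>2 - ((a + 1) * x\<^sup>2 + a\<^sup>2 * x ^ 3)"
    by (simp add: algebra_simps power2_eq_square power3_eq_cube)
  also have "\<dots> \<le> 1 - Suc a * x + (Suc a * x)\<^sup>2"
  proof -
    have "0 \<le> (a + 1) * x\<^sup>2 + a\<^sup>2 * x ^ 3"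
      using assms by (intro add_nonneg_nonneg mult_nonneg_nonneg) auto
    then show ?thesis
      by linarith
  qed
  finally show ?case .
qed simp

context orrw
begin

text \<open>For \<open>h = 1 - e * g\<close> and \<open>x = e * delayed g t\<close>, the expansion
  at 1 has linear part \<open>mB * x\<close> and error at most \<open>(B * x)^2\<close>. Taking
  \<open>g\<close> for a mean \<open>m'\<close> strictly between 1 and \<open>mB\<close> leaves the
  slack \<open>mB - m'\<close>, which absorbs the error when \<open>e\<close> is small.\<close>

lemma exists_supersolution:
  fixes q :: "nat \<Rightarrow> real"
  assumes q: "\<And>a. 0 \<le> q a" "(\<Sum>a\<le>B. q a) = 1" and m: "1 < (\<Sum>a\<le>B. q a * a)"
  shows "\<exists>h. (\<forall>k. 0 \<le> h k \<and> h k \<le> 1) \<and> h 0 = 1 \<and> h 1 < 1 \<and>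
    (\<forall>k. gamma_mean k (\<lambda>t. \<Sum>a\<le>B. q a * delayed h t ^ a) \<le> h k)"
proof -
  define mB where "mB = (\<Sum>a\<le>B. q a * a)"
  define m' where "m' = (1 + mB) / 2"
  have m': "1 < m'" "m' < mB"
    using m by (auto simp: m'_def mB_def)
  obtain g where g: "Bseq g" "\<And>k. 0 \<le> g k" "g 0 = 0" "0 < g 1" "\<And>k. g k \<le> m' * trans_op g k"
    using exists_supercritical_function[OF m'(1)] by blast
  obtain K where K: "0 < K" "\<And>k. g k \<le> K"
    using g(1) by (auto simp: Bseq_def) (meson abs_le_D1)
  \<comment> \<open>The two entries of the minimum give \<open>0 \<le> h k\<close> and an error
    within the slack; the \<open>+ 1\<close> keeps the denominator positive without a case
    distinction.\<close>
  define e where "e = min 1 ((mB - m') / (real B ^ 2 + 1)) / K"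
  have e: "0 < e" "e * K \<le> 1" "real B ^ 2 * (e * K) \<le> mB - m'"
  proof -
    have pos: "0 < real B ^ 2 + 1"
      by (simp add: add_nonneg_pos)
    show "0 < e"
      using m' K pos by (auto simp: e_def)
    have eK: "e * K = min 1 ((mB - m') / (real B ^ 2 + 1))"
      using K by (simp add: e_def)
    then show "e * K \<le> 1"
      by simp
    have "real B ^ 2 * (e * K) \<le> real B ^ 2 * ((mB - m') / (real B ^ 2 + 1))"
      unfolding eK by (intro mult_left_mono) auto
    also have "\<dots> \<le> (real B ^ 2 + 1) * ((mB - m') / (real B ^ 2 + 1))"
      using m' pos by (intro mult_right_mono) auto
    finally show "real B ^ 2 * (e * K) \<le> mB - m'"
      using pos by simp
  qed
  define h where "h k = 1 - e * g k" for k
  have h: "0 \<le> h k" "h k \<le> 1" for k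
    using order.trans[OF mult_left_mono[OF K(2)[of k], of e] e(2)] e g(2)[of k] by (auto simp: h_def)
  have Bh: "Bseq h"
    using h by (intro Bseq_unit) auto
  have delayed_h: "delayed h t = 1 - e * delayed g t" for t
  proof -
    have "delayed (\<lambda>k. 1 * 1 + (- e) * g k) t = 1 * delayed (\<lambda>_. 1) t + (- e) * delayed g t"
      by (rule delayed_lin) (auto simp: Bfun_const g(1))
    then show ?thesis
      by (simp add: h_def[abs_def] delayed_const)
  qed
  have bound: "(\<Sum>a\<le>B. q a * delayed h t ^ a) \<le> 1 * 1 + (- (m' * e)) * delayed g t" if t: "0 \<le> t" for t
  proof -
    define x where "x = e * delayed g t"
    have x0: "0 \<le> x"
      using delayed_nonneg[OF g(1,2) t] e by (simp add: x_def)
    have "delayed g t \<le> K"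
      using clock_mono[OF g(1) _ K(2) t, of False] by (simp add: clock_def Bfun_const delayed_const)
    then have xK: "x \<le> e * K"
      using e by (simp add: x_def)
    then have x1: "x \<le> 1"
      using e by simp
    have "(\<Sum>a\<le>B. q a * delayed h t ^ a) \<le> (\<Sum>a\<le>B. q a * (1 - a * x + (real B * x)\<^sup>2))"
    proof (intro sum_mono mult_left_mono q(1))
      fix a assume "a \<in> {..B}"
      then have "(a * x)\<^sup>2 \<le> (real B * x)\<^sup>2"
        using x0 by (intro power_mono mult_right_mono) auto
      then show "delayed h t ^ a \<le> 1 - a * x + (real B * x)\<^sup>2"
        using power_one_minus_le[OF x0 x1, of a] by (simp add: delayed_h x_def)
    qed
    also have "\<dots> = (\<Sum>a\<le>B. q a) - mB * x + (\<Sum>a\<le>B. q a) * (real B * x)\<^sup>2"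
      by (simp add: mB_def algebra_simps sum.distrib sum_subtractf sum_distrib_left sum_distrib_right)
    also have "\<dots> = 1 - mB * x + real B ^ 2 * x * x"
      using q(2) by (simp add: power2_eq_square)
    also have "\<dots> \<le> 1 - mB * x + (mB - m') * x"
    proof -
      have "real B ^ 2 * x \<le> mB - m'"
        using mult_left_mono[OF xK, of "real B ^ 2"] e(3) by simp
      then show ?thesis
        using x0 by (simp add: mult_right_mono)
    qed
    finally show ?thesis
      by (simp add: x_def algebra_simps)
  qed
  have "gamma_mean k (\<lambda>t. \<Sum>a\<le>B. q a * delayed h t ^ a) \<le> h k" for k
  proof -
    have tp: "tame (\<lambda>t. delayed h t ^ a)" for a
    proof (induction a)
      case (Suc a)
      then show ?case
        using tame_mult[OF tame_delayed[OF Bh] Suc] by simp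
    qed auto
    have "tame (\<lambda>t. \<Sum>a\<le>B. q a * delayed h t ^ a)"
      by (intro tame_sum tame_mult tame_const tp)
    then have "gamma_mean k (\<lambda>t. \<Sum>a\<le>B. q a * delayed h t ^ a) \<le> gamma_mean k (\<lambda>t. 1 * 1 + (- (m' * e)) * delayed g t)"
      using bound by (intro gamma_mean_mono tame_lin tame_const tame_delayed g(1)) auto
    also have "\<dots> = 1 - e * (m' * trans_op g k)"
      by (subst gamma_mean_lin[OF tame_const tame_delayed[OF g(1)]]) (simp add: gamma_mean_const trans_op_def)
    also have "\<dots> \<le> h k"
      using g(5)[of k] e by (simp add: h_def)
    finally show ?thesis .
  qed
  moreover have "h 0 = 1" "h 1 < 1"
    using g(3,4) e by (auto simp: h_def)
  ultimately show ?thesis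
    using h by blast
qed

end

section \<open>Finite-range expectations and capped offspring numbers\<close>

lemma (in prob_space) expectation_finite_range:
  fixes f :: "'b \<Rightarrow> real"
  assumes "finite F" "S \<in> measurable M (count_space F)"
  shows "expectation (\<lambda>\<omega>. f (S \<omega>)) = (\<Sum>s\<in>F. prob {\<omega> \<in> space M. S \<omega> = s} * f s)"
proof -
  have ev: "{\<omega> \<in> space M. S \<omega> = s} \<in> events" if "s \<in> F" for s
    using measurable_sets[OF assms(2), of "{s}"] that by (simp add: vimage_def Collect_conj_eq Int_commute)
  have "expectation (\<lambda>\<omega>. f (S \<omega>)) = expectation (\<lambda>\<omega>. \<Sum>s\<in>F. indicator {\<omega> \<in> space M. S \<omega> = s} \<omega> * f s)"
  proof (rule Bochner_Integration.integral_cong[OF refl])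
    fix \<omega> assume w: "\<omega> \<in> space M"
    then have "S \<omega> \<in> F"
      using measurable_space[OF assms(2)] by simp
    then show "f (S \<omega>) = (\<Sum>s\<in>F. indicator {\<omega> \<in> space M. S \<omega> = s} \<omega> * f s)"
      using w assms(1) by (simp add: indicator_def if_distrib[of "\<lambda>x. x * _"] cong: if_cong)
  qed
  also have "\<dots> = (\<Sum>s\<in>F. expectation (\<lambda>\<omega>. indicator {\<omega> \<in> space M. S \<omega> = s} \<omega> * f s))"
    using ev by (intro Bochner_Integration.integral_sum integrable_mult_left integrable_indicator)
       (auto simp: emeasure_eq_measure)
  also have "\<dots> = (\<Sum>s\<in>F. prob {\<omega> \<in> space M. S \<omega> = s} * f s)"
    using ev by (intro sum.cong refl) (simp add: emeasure_eq_measure Int_absorb2 subset_eq)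
  finally show ?thesis .
qed

lemma measurable_Int_finite:
  assumes "finite A" "\<And>w. w \<in> A \<Longrightarrow> {\<omega> \<in> space M. w \<in> S \<omega>} \<in> sets M"
  shows "(\<lambda>\<omega>. S \<omega> \<inter> A) \<in> measurable M (count_space (Pow A))"
proof (rule measurable_count_space_eq2[THEN iffD2])
  show "finite (Pow A)"
    using assms(1) by simp
  have "(\<lambda>\<omega>. S \<omega> \<inter> A) -` {C} \<inter> space M \<in> sets M" if "C \<in> Pow A" for C
  proof -
    have "(\<lambda>\<omega>. S \<omega> \<inter> A) -` {C} \<inter> space M = {\<omega> \<in> space M. \<forall>w\<in>A. w \<in> S \<omega> \<longleftrightarrow> w \<in> C}"
      using that by auto
    also have "\<dots> \<in> sets M"
      using assms by (intro sets.sets_Collect_finite_All sets.sets_Collect) auto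
    finally show ?thesis .
  qed
  then show "(\<lambda>\<omega>. S \<omega> \<inter> A) \<in> space M \<rightarrow> Pow A \<and>
      (\<forall>C\<in>Pow A. (\<lambda>\<omega>. S \<omega> \<inter> A) -` {C} \<inter> space M \<in> sets M)"
    by auto
qed

lemma truncated_mean:
  fixes p :: "nat pmf"
  assumes "integrable p real" "1 < measure_pmf.expectation p real"
  obtains B :: nat where "1 < (\<Sum>a\<le>B. measure_pmf.prob p {n. min n B = a} * a)"
    and "(\<Sum>a\<le>B. measure_pmf.prob p {n. min n B = a}) = 1"
proof -
  have "(\<lambda>B. measure_pmf.expectation p (\<lambda>n. real (min n B))) \<longlonglongrightarrow> measure_pmf.expectation p real"
  proof (rule integral_dominated_convergence)
    show "AE n in p. (\<lambda>B. real (min n B)) \<longlonglongrightarrow> real n"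
    proof (intro AE_I2 tendsto_eventually)
      fix n :: nat
      show "\<forall>\<^sub>F B in sequentially. real (min n B) = real n"
        using eventually_ge_at_top[of n] by eventually_elim simp
    qed
  qed (use assms in auto)
  then have "\<forall>\<^sub>F B in sequentially. 1 < measure_pmf.expectation p (\<lambda>n. real (min n B))"
    using assms(2) by (rule order_tendstoD(1))
  then obtain B where B: "1 < measure_pmf.expectation p (\<lambda>n. real (min n B))"
    by (auto simp: eventually_sequentially)
  have "measure_pmf.expectation p (\<lambda>n. f (min n B)) = (\<Sum>a\<le>B. measure_pmf.prob p {n. min n B = a} * f a)"
    for f :: "nat \<Rightarrow> real"
    using measure_pmf.expectation_finite_range[of "{..B}" "\<lambda>n. min n B" p f] by simp
  from this[of real] this[of "\<lambda>_. 1"] B show ?thesis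
    by (intro that[of B]) auto
qed

text \<open>The words that \<open>no_escape d B\<close> can inspect at \<open>v\<close>. Blocks of
  distinct children of a vertex are disjoint, which is the source of independence.\<close>

definition block :: "nat \<Rightarrow> nat \<Rightarrow> vertex \<Rightarrow> vertex set" where
  "block d B v = (\<lambda>w. v @ w) ` {w. set w \<subseteq> {..<B} \<and> length w \<le> d}"

lemma finite_block: "finite (block d B v)"
  by (simp add: block_def finite_lists_length_le)

lemma in_block_iff: "v @ w \<in> block d B v \<longleftrightarrow> set w \<subseteq> {..<B} \<and> length w \<le> d"
  by (auto simp: block_def)

section \<open>Independence of subtrees and the averaged recursion\<close>

locale branching_orrw = orrw \<delta> + prob_space M for \<delta> and M :: "'w measure" +
  fixes p :: "nat pmf" and N :: "vertex \<Rightarrow> 'w \<Rightarrow> nat"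
  assumes offspring: "branching_offspring M p N"
begin

lemma indep_N: "indep_vars (\<lambda>_. count_space UNIV) N UNIV"
  using offspring by (simp add: branching_offspring_def)

lemma measurable_N [measurable]: "N v \<in> measurable M (count_space UNIV)"
  using indep_N by (simp add: indep_vars_def)

lemma prob_N: "prob {\<omega> \<in> space M. P (N v \<omega>)} = measure_pmf.prob p {n. P n}"
proof -
  have "measure_pmf.prob p {n. P n} = measure (distr M (count_space UNIV) (N v)) {n. P n}"
    using offspring by (simp add: branching_offspring_def)
  also have "\<dots> = prob (N v -` {n. P n} \<inter> space M)"
    by (rule measure_distr) auto
  finally show ?thesis
    by (simp add: vimage_def Collect_conj_eq Int_commute)
qed

text \<open>Unlike in the tree, nothing is asked of the ancestors: membership of
  \<open>v @ [i]\<close> involves \<open>N v\<close> alone. Subtrees at distinct children then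
  depend on disjoint families of offspring numbers, and averages at \<open>v\<close> need no
  conditioning on \<open>v\<close> being in the tree.\<close>

definition kids :: "'w \<Rightarrow> vertex set" where
  "kids \<omega> = {v @ [i] | v i. i < N v \<omega>}"

lemma kids_iff [simp]: "v @ [i] \<in> kids \<omega> \<longleftrightarrow> i < N v \<omega>"
  by (auto simp: kids_def)

lemma measurable_block:
  assumes "finite K"
  shows "f \<in> borel_measurable (PiM K (\<lambda>_. count_space UNIV :: nat measure))"
  using assms by (subst count_space_PiM_finite) auto

text \<open>Up to depth \<open>d\<close> only offspring numbers in the block are used, so the value
  is a function of the restricted family, the form in which independence is available.\<close>

lemma no_escape_block:
  "no_escape d B (kids \<omega>) V x v = no_escape d B {u @ [i] | u i. i < (\<lambda>u\<in>block d B v. N u \<omega>) u} V x v"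
proof (intro ext no_escape_cong)
  fix w :: vertex assume w: "w \<noteq> []" "length w \<le> d" "set w \<subseteq> {..<B}"
  then obtain w' i where w': "w = w' @ [i]"
    by (metis rev_exhaust)
  have "v @ w' \<in> block d B v"
    using w by (auto simp: in_block_iff w')
  then show "v @ w \<in> kids \<omega> \<longleftrightarrow> v @ w \<in> {u @ [i] | u i. i < (\<lambda>u\<in>block d B v. N u \<omega>) u}"
    by (auto simp: w' kids_def append_assoc[symmetric] simp del: append_assoc)
qed auto

lemma measurable_kids: "(\<lambda>\<omega>. kids \<omega> \<inter> A) \<in> measurable M (count_space (Pow A))" if "finite A"
proof (rule measurable_Int_finite[OF that])
  fix w
  show "{\<omega> \<in> space M. w \<in> kids \<omega>} \<in> events"
    by (cases w rule: rev_cases) (simp_all, simp add: kids_def)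
qed

lemma no_escape_restrict:
  "no_escape d B (T \<inter> block d B v) V x v = no_escape d B T V x v"
  by (intro ext no_escape_cong) (auto simp: in_block_iff)

text \<open>\<open>S\<close> takes finitely many values, so the exchange is just linearity of
  \<open>gamma_mean\<close>, with no Fubini argument.\<close>

lemma expectation_gamma_mean:
  assumes "finite F" "S \<in> measurable M (count_space F)" "\<And>s. s \<in> F \<Longrightarrow> tame (G s)"
  shows "expectation (\<lambda>\<omega>. gamma_mean k (G (S \<omega>))) = gamma_mean k (\<lambda>t. expectation (\<lambda>\<omega>. G (S \<omega>) t))"
proof -
  have "expectation (\<lambda>\<omega>. gamma_mean k (G (S \<omega>))) = (\<Sum>s\<in>F. prob {\<omega> \<in> space M. S \<omega> = s} * gamma_mean k (G s))"
    by (rule expectation_finite_range[OF assms(1,2)])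
  also have "\<dots> = (\<Sum>s\<in>F. gamma_mean k (\<lambda>t. prob {\<omega> \<in> space M. S \<omega> = s} * G s t))"
  proof (rule sum.cong[OF refl])
    fix s assume "s \<in> F"
    then show "prob {\<omega> \<in> space M. S \<omega> = s} * gamma_mean k (G s) = gamma_mean k (\<lambda>t. prob {\<omega> \<in> space M. S \<omega> = s} * G s t)"
      using gamma_mean_lin[OF assms(3) assms(3), of s s k _ 0] by simp
  qed
  also have "\<dots> = gamma_mean k (\<lambda>t. \<Sum>s\<in>F. prob {\<omega> \<in> space M. S \<omega> = s} * G s t)"
    by (intro gamma_mean_sum[symmetric] tame_mult tame_const assms(3))
  finally show ?thesis
    by (simp add: expectation_finite_range[OF assms(1,2), of "\<lambda>s. G s _"])
qed

lemma expectation_delayed: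
  assumes "finite F" "S \<in> measurable M (count_space F)" "\<And>s. Bseq (f s)"
  shows "expectation (\<lambda>\<omega>. delayed (f (S \<omega>)) t) = delayed (\<lambda>j. expectation (\<lambda>\<omega>. f (S \<omega>) j)) t"
proof -
  have "delayed (\<lambda>j. \<Sum>s\<in>F. c s * f s j) t = (\<Sum>s\<in>F. c s * delayed (f s) t)" for c
  proof (induction F rule: infinite_finite_induct)
    case (insert s F)
    have "delayed (\<lambda>j. c s * f s j + 1 * (\<Sum>s\<in>F. c s * f s j)) t =
        c s * delayed (f s) t + 1 * delayed (\<lambda>j. \<Sum>s\<in>F. c s * f s j) t"
      by (intro delayed_lin Bseq_sum assms(3))
    then show ?case
      using insert by simp
  qed (auto simp: delayed_const)
  then show ?thesis
    by (simp add: expectation_finite_range[OF assms(1,2), of "\<lambda>s. delayed (f s) t"]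
        expectation_finite_range[OF assms(1,2), of "\<lambda>s. f s _"])
qed

abbreviation fresh :: "nat \<Rightarrow> nat \<Rightarrow> 'w \<Rightarrow> vertex \<Rightarrow> nat \<Rightarrow> real" where
  "fresh d B \<omega> \<equiv> no_escape d B (kids \<omega>) {} []"

text \<open>Distinct subtrees are independent of each other and of the number of children.\<close>

lemma expectation_prod_children:
  "expectation (\<lambda>\<omega>. \<Prod>i<min (N v \<omega>) B. delayed (fresh d B \<omega> (v @ [i])) t) =
    (\<Sum>a\<le>B. measure_pmf.prob p {n. min n B = a} *
      (\<Prod>i<a. expectation (\<lambda>\<omega>. delayed (fresh d B \<omega> (v @ [i])) t)))"
proof -
  define Y where "Y i \<omega> = delayed (fresh d B \<omega> (v @ [i])) t" for i \<omega>
  \<comment> \<open>Index 0 stands for the offspring number of \<open>v\<close>, and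
    \<open>Suc i\<close> for the subtree of its child \<open>i\<close>.\<close>
  define K where "K j = (case j of 0 \<Rightarrow> {v} | Suc i \<Rightarrow> block d B (v @ [i]))" for j
  have finK: "finite (K j)" for j
    by (simp add: K_def finite_block split: nat.split)
  have disj: "disjoint_family_on K {..B}"
    by (auto simp: disjoint_family_on_def K_def block_def split: nat.splits)
  have ind: "indep_vars (\<lambda>j. PiM (K j) (\<lambda>_. count_space UNIV)) (\<lambda>j \<omega>. restrict (\<lambda>u. N u \<omega>) (K j)) {..B}"
    by (rule indep_vars_restrict[OF indep_N _ disj]) auto
  define g where "g a j c = (case j of 0 \<Rightarrow> indicator {c. min (c v) B = a} c
      | Suc i \<Rightarrow> delayed (no_escape d B {u @ [i] | u i. i < c u} {} [] (v @ [i])) t)" for a j and c :: "vertex \<Rightarrow> nat"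
  have g0: "g a 0 (restrict (\<lambda>u. N u \<omega>) (K 0)) = indicator {\<omega>. min (N v \<omega>) B = a} \<omega>" for a \<omega>
    by (simp add: g_def K_def indicator_def)
  have gS: "g a (Suc i) (restrict (\<lambda>u. N u \<omega>) (K (Suc i))) = Y i \<omega>" for a i \<omega>
    unfolding Y_def no_escape_block by (simp only: g_def K_def nat.case)
  have indg: "indep_vars (\<lambda>_. borel) (\<lambda>j \<omega>. g a j (restrict (\<lambda>u. N u \<omega>) (K j))) {..B}" for a
    by (rule indep_vars_compose2[OF ind]) (auto intro: measurable_block finK)
  have Y01: "0 \<le> Y i \<omega> \<and> Y i \<omega> \<le> 1" if "0 \<le> t" for i \<omega>
    using that clock_unit[of "fresh d B \<omega> (v @ [i])" t False] no_escape_unit by (auto simp: Y_def clock_def)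
  \<comment> \<open>\<open>t\<close> may be negative, where \<open>delayed\<close> need not stay in
    the unit interval; the finite range gives boundedness for every \<open>t\<close>.\<close>
  have Yfin: "finite (range (Y i))" for i
  proof (rule finite_subset)
    show "range (Y i) \<subseteq> (\<lambda>A. delayed (no_escape d B A {} [] (v @ [i])) t) ` Pow (block d B (v @ [i]))"
    proof
      fix y assume "y \<in> range (Y i)"
      then obtain \<omega> where "y = Y i \<omega>"
        by auto
      then have "y = delayed (no_escape d B (kids \<omega> \<inter> block d B (v @ [i])) {} [] (v @ [i])) t"
        by (simp add: Y_def no_escape_restrict)
      then show "y \<in> (\<lambda>A. delayed (no_escape d B A {} [] (v @ [i])) t) ` Pow (block d B (v @ [i]))"
        by auto
    qed
  qed (simp add: finite_block)
  have Yint: "integrable M (Y i)" if "i < B" for i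
  proof -
    have "(\<lambda>\<omega>. g 0 (Suc i) (restrict (\<lambda>u. N u \<omega>) (K (Suc i)))) \<in> borel_measurable M"
      using indg[of 0] that by (auto simp: indep_vars_def)
    then have "Y i \<in> borel_measurable M"
      by (simp add: gS)
    moreover obtain C where "\<And>\<omega>. norm (Y i \<omega>) \<le> C"
      using finite_imp_bounded[OF Yfin[of i]] by (auto simp: bounded_iff)
    ultimately show ?thesis
      by (intro integrable_const_bound[of _ C]) auto
  qed
  have gint: "integrable M (\<lambda>\<omega>. g a j (restrict (\<lambda>u. N u \<omega>) (K j)))" if "j \<le> B" for a j
  proof (cases j)
    case 0
    then show ?thesis
      unfolding 0 g0 by (intro integrable_const_bound[of _ 1]) (auto simp: indicator_def)
  next
    case (Suc i)
    then show ?thesis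
      using Yint[of i] that by (simp add: gS)
  qed
  have one: "expectation (\<lambda>\<omega>. indicator {\<omega>. min (N v \<omega>) B = a} \<omega> * (\<Prod>i<a. Y i \<omega>)) =
      measure_pmf.prob p {n. min n B = a} * (\<Prod>i<a. expectation (Y i))"
    "integrable M (\<lambda>\<omega>. indicator {\<omega>. min (N v \<omega>) B = a} \<omega> * (\<Prod>i<a. Y i \<omega>))" if "a \<le> B" for a
  proof -
    have i: "indep_vars (\<lambda>_. borel) (\<lambda>j \<omega>. g a j (restrict (\<lambda>u. N u \<omega>) (K j))) {..a}"
      using indep_vars_subset[OF indg] that by auto
    have eq: "(\<Prod>j\<le>a. g a j (restrict (\<lambda>u. N u \<omega>) (K j))) =
        indicator {\<omega>. min (N v \<omega>) B = a} \<omega> * (\<Prod>i<a. Y i \<omega>)" for \<omega>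
      by (simp only: prod.atMost_shift g0 gS)
    have "expectation (\<lambda>\<omega>. \<Prod>j\<le>a. g a j (restrict (\<lambda>u. N u \<omega>) (K j))) =
        (\<Prod>j\<le>a. expectation (\<lambda>\<omega>. g a j (restrict (\<lambda>u. N u \<omega>) (K j))))"
      using that gint by (intro indep_vars_lebesgue_integral i) auto
    also have "\<dots> = expectation (indicator {\<omega>. min (N v \<omega>) B = a}) * (\<Prod>i<a. expectation (Y i))"
      by (simp only: prod.atMost_shift g0 gS)
    also have "expectation (indicator {\<omega>. min (N v \<omega>) B = a}) = prob {\<omega> \<in> space M. min (N v \<omega>) B = a}"
      by (simp add: Collect_conj_eq Int_commute)
    also have "\<dots> = measure_pmf.prob p {n. min n B = a}"
      by (rule prob_N)
    finally show "expectation (\<lambda>\<omega>. indicator {\<omega>. min (N v \<omega>) B = a} \<omega> * (\<Prod>i<a. Y i \<omega>)) =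
      measure_pmf.prob p {n. min n B = a} * (\<Prod>i<a. expectation (Y i))"
      by (simp only: eq)
    have "integrable M (\<lambda>\<omega>. \<Prod>j\<le>a. g a j (restrict (\<lambda>u. N u \<omega>) (K j)))"
      using that gint by (intro indep_vars_integrable i) auto
    then show "integrable M (\<lambda>\<omega>. indicator {\<omega>. min (N v \<omega>) B = a} \<omega> * (\<Prod>i<a. Y i \<omega>))"
      by (simp only: eq)
  qed
  \<comment> \<open>Fixing the capped number of children turns the random product into products of
    fixed length, to which independence applies.\<close>
  have "(\<Prod>i<min (N v \<omega>) B. Y i \<omega>) = (\<Sum>a\<le>B. indicator {\<omega>. min (N v \<omega>) B = a} \<omega> * (\<Prod>i<a. Y i \<omega>))" for \<omega>
    by (simp add: indicator_def if_distrib[of "\<lambda>x. x * _"] cong: if_cong)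
  then have "expectation (\<lambda>\<omega>. \<Prod>i<min (N v \<omega>) B. Y i \<omega>) =
      expectation (\<lambda>\<omega>. \<Sum>a\<le>B. indicator {\<omega>. min (N v \<omega>) B = a} \<omega> * (\<Prod>i<a. Y i \<omega>))"
    by presburger
  also have "\<dots> = (\<Sum>a\<le>B. measure_pmf.prob p {n. min n B = a} * (\<Prod>i<a. expectation (Y i)))"
    using one by (subst Bochner_Integration.integral_sum) auto
  finally show ?thesis
    by (simp add: Y_def[abs_def])
qed

text \<open>Independence makes the averages satisfy a recursion with monotone operators, of which
  \<open>h\<close> is a supersolution, so the bound passes from depth to depth. At depth 0 the value
  is the indicator of \<open>k = 0\<close>, which is below \<open>h\<close> because
  \<open>h 0 = 1\<close>.\<close>

lemma expectation_fresh_le: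
  assumes h: "\<And>k. 0 \<le> h k \<and> h k \<le> 1" "h 0 = 1"
    and super: "\<And>k. gamma_mean k (\<lambda>t. \<Sum>a\<le>B. measure_pmf.prob p {n. min n B = a} * delayed h t ^ a) \<le> h k"
  shows "expectation (\<lambda>\<omega>. fresh d B \<omega> v k) \<le> h k"
proof (induction d arbitrary: v k)
  case 0
  then show ?case
    using h(1)[of k] h(2) by (simp add: prob_space)
next
  case (Suc d)
  have Bh: "Bseq h"
    using h(1) by (rule Bseq_unit)
  define A where "A = block (Suc d) B v"
  define q where "q a = measure_pmf.prob p {n. min n B = a}" for a
  define G where "G T t = (\<Prod>i | i < B \<and> v @ [i] \<in> T. delayed (no_escape d B T {} [] (v @ [i])) t)" for T t
  have mA: "(\<lambda>\<omega>. kids \<omega> \<inter> A) \<in> measurable M (count_space (Pow A))" "finite (Pow A)"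
    by (auto simp: A_def finite_block intro: measurable_kids)
  have tG: "tame (G T)" for T
    unfolding G_def[abs_def] using Bseq_no_escape[where c = 0] by (intro tame_prod tame_delayed) auto
  have GA: "G (T \<inter> A) = G T" for T
  proof -
    have "no_escape d B (T \<inter> A) {} [] (v @ [i]) = no_escape d B T {} [] (v @ [i])" if "i < B" for i
    proof (intro ext no_escape_cong)
      fix w :: vertex assume "w \<noteq> []" "length w \<le> d" "set w \<subseteq> {..<B}"
      then show "(v @ [i]) @ w \<in> T \<inter> A \<longleftrightarrow> (v @ [i]) @ w \<in> T"
        using that by (simp add: A_def in_block_iff)
    qed auto
    moreover have "{i. i < B \<and> v @ [i] \<in> T \<inter> A} = {i. i < B \<and> v @ [i] \<in> T}"
      by (auto simp: A_def in_block_iff)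
    ultimately show ?thesis
      unfolding G_def[abs_def] by (auto intro!: ext prod.cong)
  qed
  have "expectation (\<lambda>\<omega>. fresh (Suc d) B \<omega> v k) = expectation (\<lambda>\<omega>. gamma_mean k (G (kids \<omega> \<inter> A)))"
    by (simp add: GA) (simp add: G_def[abs_def] clock_def entering_def)
  also have "\<dots> = gamma_mean k (\<lambda>t. expectation (\<lambda>\<omega>. G (kids \<omega> \<inter> A) t))"
    by (rule expectation_gamma_mean[OF mA(2,1) tG])
  also have "\<dots> \<le> gamma_mean k (\<lambda>t. \<Sum>a\<le>B. q a * delayed h t ^ a)"
  proof (rule gamma_mean_mono)
    show "tame (\<lambda>t. expectation (\<lambda>\<omega>. G (kids \<omega> \<inter> A) t))"
      unfolding expectation_finite_range[OF mA(2,1), of "\<lambda>s. G s _"]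
      by (intro tame_sum tame_mult tame_const tG)
    have "tame (\<lambda>t. \<Prod>i<a. delayed h t)" for a :: nat
      by (intro tame_prod tame_delayed Bh)
    then have "tame (\<lambda>t. delayed h t ^ a)" for a
      by simp
    then show "tame (\<lambda>t. \<Sum>a\<le>B. q a * delayed h t ^ a)"
      by (intro tame_sum tame_mult tame_const)
    fix t :: real assume t: "0 \<le> t"
    have "expectation (\<lambda>\<omega>. G (kids \<omega> \<inter> A) t) =
        expectation (\<lambda>\<omega>. \<Prod>i<min (N v \<omega>) B. delayed (fresh d B \<omega> (v @ [i])) t)"
    proof -
      have "{i. i < B \<and> i < n} = {..<min n B}" for n
        by auto
      then show ?thesis
        by (simp add: GA) (simp add: G_def)
    qed
    also have "\<dots> = (\<Sum>a\<le>B. q a * (\<Prod>i<a. expectation (\<lambda>\<omega>. delayed (fresh d B \<omega> (v @ [i])) t)))"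
      unfolding q_def by (rule expectation_prod_children)
    also have "\<dots> \<le> (\<Sum>a\<le>B. q a * (\<Prod>i<a. delayed h t))"
    proof (intro sum_mono mult_left_mono prod_mono conjI)
      fix i
      let ?f = "\<lambda>T. no_escape d B T {} [] (v @ [i])"
      let ?E = "\<lambda>j. expectation (\<lambda>\<omega>. fresh d B \<omega> (v @ [i]) j)"
      have "expectation (\<lambda>\<omega>. delayed (fresh d B \<omega> (v @ [i])) t) =
          expectation (\<lambda>\<omega>. delayed (?f (kids \<omega> \<inter> block d B (v @ [i]))) t)"
        by (simp only: no_escape_restrict)
      also have "\<dots> = delayed (\<lambda>j. expectation (\<lambda>\<omega>. ?f (kids \<omega> \<inter> block d B (v @ [i])) j)) t"
        using Bseq_no_escape[where c = 0]
        by (intro expectation_delayed[of "Pow (block d B (v @ [i]))"] measurable_kids finite_block) (auto simp: finite_block)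
      finally have eq: "expectation (\<lambda>\<omega>. delayed (fresh d B \<omega> (v @ [i])) t) = delayed ?E t"
        by (simp only: no_escape_restrict)
      have E: "0 \<le> ?E j" "?E j \<le> h j" for j
        using no_escape_unit Suc.IH by (auto intro!: integral_nonneg)
      then have BE: "Bseq ?E"
        using h(1) by (intro Bseq_unit) (meson order.trans)
      show "0 \<le> expectation (\<lambda>\<omega>. delayed (fresh d B \<omega> (v @ [i])) t)"
        unfolding eq by (rule delayed_nonneg[OF BE E(1) t])
      show "expectation (\<lambda>\<omega>. delayed (fresh d B \<omega> (v @ [i])) t) \<le> delayed h t"
        unfolding eq using clock_mono[OF BE Bh E(2) t, of False] by (simp add: clock_def)
    qed (auto simp: q_def)
    finally show "expectation (\<lambda>\<omega>. G (kids \<omega> \<inter> A) t) \<le> (\<Sum>a\<le>B. q a * delayed h t ^ a)"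
      by simp
  qed
  also have "\<dots> \<le> h k"
    unfolding q_def by (rule super)
  finally show ?case .
qed

end

subsection \<open>One step of the walk on a fixed tree\<close>

definition rooted_tree :: "vertex set \<Rightarrow> bool" where
  "rooted_tree T \<longleftrightarrow> [] \<in> T \<and> (\<forall>v i. v @ [i] \<in> T \<longrightarrow> v \<in> T) \<and> (\<forall>v. finite {i. v @ [i] \<in> T})"

lemma genealogical_tree_Nil: "[] \<in> genealogical_tree c"
  by (simp add: genealogical_tree_def)

lemma genealogical_tree_snoc: "v @ [i] \<in> genealogical_tree c \<longleftrightarrow> v \<in> genealogical_tree c \<and> i < c v"
  by (auto simp: genealogical_tree_def nth_append less_Suc_eq)

lemma rooted_genealogical_tree: "rooted_tree (genealogical_tree c)"
proof -
  have "finite {i. v @ [i] \<in> genealogical_tree c}" for v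
    by (rule finite_subset[of _ "{..<c v}"]) (auto simp: genealogical_tree_snoc)
  then show ?thesis
    by (auto simp: rooted_tree_def genealogical_tree_Nil genealogical_tree_snoc)
qed

lemma rooted_tree_prefix: "rooted_tree T \<Longrightarrow> v \<in> T \<Longrightarrow> prefix w v \<Longrightarrow> w \<in> T"
  by (induction v rule: rev_induct) (auto simp: rooted_tree_def)

lemma tree_adj_neighbours:
  assumes "rooted_tree T" "v \<in> T" "v \<noteq> []"
  shows "{u. tree_adj T v u} = insert (butlast v) ((\<lambda>i. v @ [i]) ` {i. v @ [i] \<in> T})"
proof -
  have "butlast v \<in> T"
    using assms(1,2) prefixeq_butlast by (rule rooted_tree_prefix)
  moreover have "v = butlast v @ [last v]"
    using assms(3) by simp
  ultimately show ?thesis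
    using assms(2) by (auto simp: tree_adj_def)
qed

lemma tree_adj_root: "[] \<in> T \<Longrightarrow> {u. tree_adj T [] u} = (\<lambda>i. [i]) ` {i. [i] \<in> T}"
  by (auto simp: tree_adj_def)

definition edges :: "(nat \<Rightarrow> vertex) \<Rightarrow> nat \<Rightarrow> vertex set" where
  "edges x k = {v. v \<noteq> [] \<and> traversed x k (butlast v) v}"

lemma edges_0: "edges x 0 = {}"
  by (simp add: edges_def traversed_def)

lemma edges_Suc:
  "edges x (Suc k) = edges x k \<union> {v. v \<noteq> [] \<and> x k \<in> {butlast v, v} \<and> x (Suc k) \<in> {butlast v, v}}"
  by (auto simp: edges_def traversed_def less_Suc_eq)

lemma edges_cong: "(\<And>j. j \<le> k \<Longrightarrow> x j = x' j) \<Longrightarrow> edges x k = edges x' k"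
  by (auto simp: edges_def traversed_def)

lemma edge_down: "{v. v \<noteq> [] \<and> u \<in> {butlast v, v} \<and> u @ [i] \<in> {butlast v, v}} = {u @ [i]}"
proof -
  have False if "v \<noteq> []" "u = v" "u @ [i] = butlast v" for v
    using arg_cong[OF that(3), of length] that(2) by simp
  then show ?thesis
    by auto
qed

lemma edge_up:
  assumes "u \<noteq> []"
  shows "{v. v \<noteq> [] \<and> u \<in> {butlast v, v} \<and> butlast u \<in> {butlast v, v}} = {u}"
  using edge_down[of "butlast u" "last u"] assms by auto

definition tree_path :: "vertex set \<Rightarrow> (nat \<Rightarrow> vertex) \<Rightarrow> nat \<Rightarrow> bool" where
  "tree_path T x k \<longleftrightarrow> x 0 = [] \<and> (\<forall>j<k. tree_adj T (x j) (x (Suc j)))"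

text \<open>In a tree a position can be reached from the root only across all edges in between. This
  provides the traversed edges required in \<open>no_escape_harmonic\<close>.\<close>

lemma tree_path_prefix_edges:
  assumes "tree_path T x k" "prefix w (x k)" "w \<noteq> []"
  shows "w \<in> edges x k"
  using assms
proof (induction k arbitrary: w)
  case 0
  then show ?case
    by (simp add: tree_path_def)
next
  case (Suc k)
  have p: "tree_path T x k" and adj: "tree_adj T (x k) (x (Suc k))"
    using Suc.prems(1) by (auto simp: tree_path_def)
  then consider i where "x (Suc k) = x k @ [i]" | i where "x k = x (Suc k) @ [i]"
    by (auto simp: tree_adj_def)
  then show ?case
  proof cases
    case 1
    then consider "w = x k @ [i]" | "prefix w (x k)"
      using Suc.prems(2) by auto
    then show ?thesis
      using Suc.IH[OF p] Suc.prems(3) 1 by cases (auto simp: edges_Suc)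
  next
    case 2
    then have "prefix w (x k)"
      using Suc.prems(2) by simp
    then show ?thesis
      using Suc.IH[OF p] Suc.prems(3) by (simp add: edges_Suc)
  qed
qed

lemma tree_path_length: "tree_path T x k \<Longrightarrow> length (x k) \<le> k"
proof (induction k)
  case (Suc k)
  then show ?case
    by (auto simp: tree_path_def tree_adj_def)
qed (simp add: tree_path_def)

lemma tree_path_in_tree: "tree_path T x k \<Longrightarrow> [] \<in> T \<Longrightarrow> x k \<in> T"
  by (cases k) (auto simp: tree_path_def tree_adj_def)

section \<open>Escape probabilities along a trajectory\<close>

context orrw
begin

text \<open>The conditional probability at time \<open>k\<close> that a walk with first position \<open>[0]\<close> gets \<open>n\<close> levels below
  \<open>[0]\<close>, through children with index less than \<open>B\<close>, before it returns to the root; it is 0 on other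
  trajectories.\<close>

definition avoid :: "nat \<Rightarrow> nat \<Rightarrow> vertex set \<Rightarrow> (nat \<Rightarrow> vertex) \<Rightarrow> nat \<Rightarrow> real" where
  "avoid n B T x k =
     (if tree_path T x k \<and> (\<forall>j. 1 \<le> j \<and> j \<le> k \<longrightarrow> prefix [0] (x j))
      then 1 - no_escape n B T (edges x k) (x k) [0] 1 else 0)"

lemma avoid_unit: "0 \<le> avoid n B T x k \<and> avoid n B T x k \<le> 1"
  using no_escape_unit by (simp add: avoid_def)

lemma tree_path_cong: "(\<And>j. j \<le> k \<Longrightarrow> x j = x' j) \<Longrightarrow> tree_path T x k \<longleftrightarrow> tree_path T x' k"
  by (auto simp: tree_path_def)

lemma avoid_cong:
  assumes "\<And>j. j \<le> k \<Longrightarrow> x j = x' j"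
  shows "avoid n B T x k = avoid n B T x' k"
  using assms tree_path_cong[of k x x' T] edges_cong[of k x x'] by (auto simp: avoid_def)

lemma orrw_step_nonneg: "0 \<le> orrw_step adj \<delta> x k v"
  using delta_pos by (auto simp: orrw_step_def edge_weight_def intro!: divide_nonneg_nonneg sum_nonneg)

text \<open>The submartingale property. On the trajectories counted by \<open>avoid\<close> it is
  the harmonic equation; on all others the left side is 0. The bound \<open>k \<le> n\<close> keeps
  the walk above the depth at which \<open>no_escape\<close> stops.\<close>

lemma avoid_step:
  assumes T: "rooted_tree T" and k: "1 \<le> k" "k \<le> n"
  shows "avoid n B T x k \<le> (\<Sum>y | tree_adj T (x k) y.
     orrw_step (tree_adj T) \<delta> x k y * avoid n B T (x(Suc k := y)) (Suc k))"
proof (cases "tree_path T x k \<and> (\<forall>j. 1 \<le> j \<and> j \<le> k \<longrightarrow> prefix [0] (x j))")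
  case False
  then show ?thesis
    by (subst avoid_def) (auto intro!: sum_nonneg mult_nonneg_nonneg orrw_step_nonneg simp: avoid_unit)
next
  case True
  then have p: "tree_path T x k" and stay: "\<And>j. 1 \<le> j \<Longrightarrow> j \<le> k \<Longrightarrow> prefix [0] (x j)"
    by auto
  define v where "v = x k"
  define V where "V = edges x k"
  define C where "C = {i. v @ [i] \<in> T}"
  define w where "w i = rate (v @ [i] \<in> V)" for i
  define W where "W = \<delta> + (\<Sum>i\<in>C. w i)"
  have v0: "prefix [0] v"
    using stay k by (simp add: v_def)
  then have v_ne: "v \<noteq> []"
    by auto
  have vT: "v \<in> T"
    using tree_path_in_tree[OF p] T by (simp add: v_def rooted_tree_def)
  have finC: "finite C"
    using T by (simp add: C_def rooted_tree_def)
  have w_pos: "0 < w i" for i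
    using delta_pos by (simp add: w_def rate_def)
  have W_pos: "0 < W"
    unfolding W_def using delta_pos w_pos by (intro add_pos_nonneg sum_nonneg less_imp_le)
  obtain u where u: "v = [0] @ u"
    using v0 by (auto simp: prefix_def)
  have len: "length u < n"
    using tree_path_length[OF p] k by (simp add: v_def[symmetric] u)
  have nb: "{y. tree_adj T v y} = insert (butlast v) ((\<lambda>i. v @ [i]) ` C)"
    unfolding C_def by (rule tree_adj_neighbours[OF T vT v_ne])
  have notin: "butlast v \<notin> (\<lambda>i. v @ [i]) ` C"
  proof
    assume "butlast v \<in> (\<lambda>i. v @ [i]) ` C"
    then have "prefix (v @ []) (butlast v)"
      by auto
    then show False
      using not_prefix_butlast[OF v_ne, of "[]"] by blast
  qed
  have inj: "inj_on (\<lambda>i. v @ [i]) C"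
    by (auto simp: inj_on_def)
  have sum_nb: "(\<Sum>y | tree_adj T v y. f y) = f (butlast v) + (\<Sum>i\<in>C. f (v @ [i]))" for f :: "vertex \<Rightarrow> real"
    unfolding nb using finC notin by (simp add: sum.reindex[OF inj])
  have pV: "a \<in> V" if "prefix a v" "a \<noteq> []" for a
    using tree_path_prefix_edges[OF p] that by (simp add: v_def V_def)
  have ew_down: "edge_weight \<delta> x k v (v @ [i]) = w i" for i
    by (simp add: edge_weight_def w_def rate_def V_def edges_def)
  have ew_up: "edge_weight \<delta> x k v (butlast v) = \<delta>"
    using pV[of v] v_ne by (simp add: edge_weight_def V_def edges_def traversed_def insert_commute)
  have ex: "\<exists>u. tree_adj T v u"
    using nb by auto
  have total: "(\<Sum>u | tree_adj T v u. edge_weight \<delta> x k v u) = W"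
    by (simp add: sum_nb ew_down ew_up W_def)
  have step_down: "orrw_step (tree_adj T) \<delta> x k (v @ [i]) = w i / W" if "i \<in> C" for i
  proof -
    have "tree_adj T v (v @ [i])"
      using that nb by blast
    then show ?thesis
      using ex by (auto simp: orrw_step_def v_def[symmetric] total ew_down)
  qed
  have step_up: "orrw_step (tree_adj T) \<delta> x k (butlast v) = \<delta> / W"
  proof -
    have "tree_adj T v (butlast v)"
      using nb by blast
    then show ?thesis
      using ex by (auto simp: orrw_step_def v_def[symmetric] total ew_up)
  qed
  have tree_path_Suc: "tree_path T (x(Suc k := y)) (Suc k)" if "tree_adj T v y" for y
    using p that by (auto simp: tree_path_def less_Suc_eq v_def)
  have edges_upd: "edges (x(Suc k := y)) (Suc k) =
      V \<union> {a. a \<noteq> [] \<and> v \<in> {butlast a, a} \<and> y \<in> {butlast a, a}}" for y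
    using edges_cong[of k "x(Suc k := y)" x] by (simp add: edges_Suc V_def v_def)
  have A_down: "avoid n B T (x(Suc k := v @ [i])) (Suc k) = 1 - no_escape n B T (insert (v @ [i]) V) (v @ [i]) [0] (Suc 0)"
    if "i \<in> C" for i
  proof -
    have "tree_path T (x(Suc k := v @ [i])) (Suc k)"
      using that nb by (intro tree_path_Suc) blast
    moreover have "\<forall>j. 1 \<le> j \<and> j \<le> Suc k \<longrightarrow> prefix [0] ((x(Suc k := v @ [i])) j)"
      using stay v0 by (auto simp: le_Suc_eq)
    moreover have "edges (x(Suc k := v @ [i])) (Suc k) = insert (v @ [i]) V"
      unfolding edges_upd edge_down by simp
    ultimately show ?thesis
      by (simp add: avoid_def)
  qed
  \<comment> \<open>The step up either stays in the subtree of \<open>[0]\<close>, with one crossing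
    pending, or reaches the root. Then \<open>avoid\<close> is 0 by definition and the count 0 makes
    \<open>no_escape\<close> equal to 1.\<close>
  have A_up: "avoid n B T (x(Suc k := butlast v)) (Suc k) =
      1 - no_escape n B T V (butlast v) [0] (0 + entering (butlast v) [0])"
  proof -
    have tree_path: "tree_path T (x(Suc k := butlast v)) (Suc k)"
      using nb by (intro tree_path_Suc) blast
    have e: "edges (x(Suc k := butlast v)) (Suc k) = V"
      unfolding edges_upd edge_up[OF v_ne] using pV[of v] v_ne by auto
    show ?thesis
    proof (cases "prefix [0] (butlast v)")
      case True
      then have "\<forall>j. 1 \<le> j \<and> j \<le> Suc k \<longrightarrow> prefix [0] ((x(Suc k := butlast v)) j)"
        using stay by (auto simp: le_Suc_eq)
      then show ?thesis
        using tree_path e True by (simp add: avoid_def entering_def)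
    next
      case False
      then have "\<not> prefix ([0] @ a) (butlast v)" for a
        by (auto simp: prefix_def)
      then have "no_escape n B T V (butlast v) [0] 0 = 1"
        by (intro no_escape_zero) blast
      moreover have "avoid n B T (x(Suc k := butlast v)) (Suc k) = 0"
        unfolding avoid_def using False by (intro if_not_P) (auto intro!: exI[of _ "Suc k"])
      ultimately show ?thesis
        using False by (simp add: entering_def)
    qed
  qed
  have harm: "\<delta> * no_escape n B T V (butlast v) [0] (0 + entering (butlast v) [0]) +
      (\<Sum>i\<in>C. w i * no_escape n B T (insert (v @ [i]) V) (v @ [i]) [0] (Suc 0)) = W * no_escape n B T V v [0] (Suc 0)"
    unfolding C_def w_def W_def
  proof (rule no_escape_harmonic[OF u len v_ne])
    show "finite {i. v @ [i] \<in> T}"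
      using finC by (simp add: C_def)
    show "a \<in> T" if "prefix a v" for a
      using rooted_tree_prefix[OF T vT that] .
  qed (rule pV)
  have "(\<Sum>y | tree_adj T v y. orrw_step (tree_adj T) \<delta> x k y * avoid n B T (x(Suc k := y)) (Suc k)) =
      \<delta> / W * (1 - no_escape n B T V (butlast v) [0] (0 + entering (butlast v) [0])) +
      (\<Sum>i\<in>C. w i / W * (1 - no_escape n B T (insert (v @ [i]) V) (v @ [i]) [0] (Suc 0)))"
    unfolding sum_nb step_up A_up by (simp add: step_down A_down)
  also have "\<dots> = \<delta> / W + (\<Sum>i\<in>C. w i / W) - (\<delta> * no_escape n B T V (butlast v) [0] (0 + entering (butlast v) [0]) +
      (\<Sum>i\<in>C. w i * no_escape n B T (insert (v @ [i]) V) (v @ [i]) [0] (Suc 0))) / W"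
    by (simp add: add_divide_distrib right_diff_distrib sum_subtractf sum_divide_distrib)
  also have "\<delta> / W + (\<Sum>i\<in>C. w i / W) = 1"
    unfolding sum_divide_distrib[symmetric] add_divide_distrib[symmetric] using W_pos by (simp add: W_def)
  also have "1 - (\<delta> * no_escape n B T V (butlast v) [0] (0 + entering (butlast v) [0]) +
      (\<Sum>i\<in>C. w i * no_escape n B T (insert (v @ [i]) V) (v @ [i]) [0] (Suc 0))) / W = 1 - no_escape n B T V v [0] (Suc 0)"
    unfolding harm using W_pos by simp
  also have "\<dots> = avoid n B T x k"
    using True by (simp add: avoid_def V_def v_def)
  finally show ?thesis
    by (simp only: v_def order.refl)
qed

text \<open>At time 0 all edges have weight 1. The crossed edge and the new position are invisible
  to \<open>no_escape\<close> at \<open>[0]\<close>, so the untouched initial state may replace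
  them.\<close>

lemma avoid_first_step:
  assumes T: "rooted_tree T" and x: "x 0 = []" and "[0] \<in> T"
  shows "orrw_step (tree_adj T) \<delta> x 0 [0] * avoid n B T (x(Suc 0 := [0])) (Suc 0) =
    1 / card {i. [i] \<in> T} * (1 - no_escape n B T {} [] [0] 1)"
proof -
  have root: "[] \<in> T"
    using T by (simp add: rooted_tree_def)
  have adj: "tree_adj T [] [0]"
    using root assms(3) by (auto simp: tree_adj_def)
  have "(\<Sum>u | tree_adj T [] u. edge_weight \<delta> x 0 [] u) = card {i. [i] \<in> T}"
    unfolding tree_adj_root[OF root]
    by (simp add: edge_weight_def traversed_def card_image inj_on_def)
  then have s: "orrw_step (tree_adj T) \<delta> x 0 [0] = 1 / card {i. [i] \<in> T}"
    using adj by (auto simp: orrw_step_def x edge_weight_def traversed_def)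
  have "edges (x(Suc 0 := [0])) (Suc 0) = {[0]}"
    using edge_down[of "[]" 0] by (simp add: edges_Suc edges_0 x)
  moreover have "tree_path T (x(Suc 0 := [0])) (Suc 0)"
    using adj by (simp add: tree_path_def x)
  moreover have "no_escape n B T {[0]} [0] [0] 1 = no_escape n B T {} [] [0] 1"
    by (rule no_escape_cong) auto
  moreover have "\<forall>j. 1 \<le> j \<and> j \<le> Suc 0 \<longrightarrow> prefix [0] ((x(Suc 0 := [0])) j)"
    by (auto simp: le_Suc_eq)
  ultimately show ?thesis
    by (simp add: s avoid_def)
qed

lemma avoid_tree_cong:
  assumes "T \<inter> (x ` {..k} \<union> block n B [0]) = T' \<inter> (x ` {..k} \<union> block n B [0])"
  shows "avoid n B T x k = avoid n B T' x k"
proof -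
  have "x j \<in> T \<longleftrightarrow> x j \<in> T'" if "j \<le> k" for j
    using assms that by blast
  then have "tree_path T x k \<longleftrightarrow> tree_path T' x k"
    by (auto simp: tree_path_def tree_adj_def)
  moreover have "no_escape n B T V v [0] j = no_escape n B T' V v [0] j" for V v j
  proof (rule no_escape_cong)
    fix w :: vertex assume "length w \<le> n" "set w \<subseteq> {..<B}"
    then have "[0] @ w \<in> block n B [0]"
      by (subst in_block_iff) simp
    then show "[0] @ w \<in> T \<longleftrightarrow> [0] @ w \<in> T'"
      using assms by blast
  qed auto
  ultimately show ?thesis
    by (simp only: avoid_def)
qed

end

subsection \<open>Transience\<close>

context branching_orrw
begin

abbreviation tree :: "'w \<Rightarrow> vertex set" where
  "tree \<omega> \<equiv> genealogical_tree (\<lambda>v. N v \<omega>)"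

text \<open>The recursion descends only through existing children, so from a vertex of the tree it
  never meets the words on which \<open>kids\<close> and the tree differ.\<close>

lemma no_escape_tree: "v \<in> tree \<omega> \<Longrightarrow> no_escape d B (tree \<omega>) V x v k = no_escape d B (kids \<omega>) V x v k"
proof (induction d arbitrary: v k)
  case (Suc d)
  have "v @ [i] \<in> tree \<omega> \<longleftrightarrow> i < N v \<omega>" for i
    using Suc.prems by (simp add: genealogical_tree_snoc)
  with Suc.IH show ?case
    unfolding no_escape.simps by (auto intro!: arg_cong[where f = "gamma_mean k"] ext prod.cong)
qed simp

lemma measurable_fresh: "(\<lambda>\<omega>. fresh d B \<omega> v k) \<in> borel_measurable M"
proof -
  have "(\<lambda>\<omega>. no_escape d B (kids \<omega> \<inter> block d B v) {} [] v k) \<in> borel_measurable M"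
    by (rule measurable_compose[OF measurable_kids[OF finite_block]]) simp
  then show ?thesis
    by (simp only: no_escape_restrict)
qed

text \<open>The offspring number of the root is independent of those in the block of
  \<open>[0]\<close>. For a childless root \<open>1 / N []\<close> is 0 by convention, which is the
  right chance of a first step to \<open>[0]\<close>.\<close>

lemma expectation_first_step:
  "expectation (\<lambda>\<omega>. 1 / N [] \<omega> * (1 - fresh n B \<omega> [0] 1)) =
    expectation (\<lambda>\<omega>. 1 / N [] \<omega>) * (1 - expectation (\<lambda>\<omega>. fresh n B \<omega> [0] 1))"
proof -
  define K where "K j = (if j = 0 then {[]} else block n B [0])" for j :: nat
  define g where "g j c = (if j = 0 then 1 / c [] else 1 - no_escape n B {u @ [i] | u i. i < c u} {} [] [0] 1)"
    for j :: nat and c :: "vertex \<Rightarrow> nat"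
  have "disjoint_family_on K {..1}"
    by (auto simp: disjoint_family_on_def K_def block_def)
  then have "indep_vars (\<lambda>j. PiM (K j) (\<lambda>_. count_space UNIV)) (\<lambda>j \<omega>. restrict (\<lambda>u. N u \<omega>) (K j)) {..1}"
    by (intro indep_vars_restrict[OF indep_N]) auto
  then have ind: "indep_vars (\<lambda>_. borel) (\<lambda>j \<omega>. g j (restrict (\<lambda>u. N u \<omega>) (K j))) {..1}"
    by (rule indep_vars_compose2) (auto intro!: measurable_block simp: K_def finite_block)
  have g0: "g 0 (restrict (\<lambda>u. N u \<omega>) (K 0)) = 1 / N [] \<omega>" for \<omega>
    by (simp add: g_def K_def)
  have g1: "g (Suc 0) (restrict (\<lambda>u. N u \<omega>) (K (Suc 0))) = 1 - fresh n B \<omega> [0] 1" for \<omega>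
    unfolding no_escape_block by (simp add: g_def K_def)
  have int: "integrable M (\<lambda>\<omega>. fresh n B \<omega> [0] 1)"
    using no_escape_unit by (intro integrable_const_bound[of _ 1] measurable_fresh) (auto simp: abs_le_iff intro: order.trans)
  have int0: "integrable M (\<lambda>\<omega>. 1 / N [] \<omega>)"
    by (intro integrable_const_bound[of _ 1]) (auto simp: divide_le_eq)
  have "expectation (\<lambda>\<omega>. \<Prod>j\<le>1. g j (restrict (\<lambda>u. N u \<omega>) (K j))) =
      (\<Prod>j\<le>1. expectation (\<lambda>\<omega>. g j (restrict (\<lambda>u. N u \<omega>) (K j))))"
  proof (rule indep_vars_lebesgue_integral[OF _ ind])
    fix j :: nat assume "j \<in> {..1}"
    then consider "j = 0" | "j = Suc 0"
      by fastforce
    then show "integrable M (\<lambda>\<omega>. g j (restrict (\<lambda>u. N u \<omega>) (K j)))"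
      by cases (use int int0 in \<open>simp_all only: g0 g1, auto\<close>)
  qed simp
  then show ?thesis
    using int by (simp add: g0 g1 prob_space)
qed

lemma expectation_first_step_pos:
  assumes "0 < pmf p a" "0 < a"
  shows "0 < expectation (\<lambda>\<omega>. 1 / N [] \<omega>)"
proof -
  have "prob {\<omega> \<in> space M. N [] \<omega> = a} = pmf p a"
    using prob_N[of "\<lambda>n. n = a" "[]"] by (simp add: measure_pmf_single)
  then have "0 < 1 / a * prob {\<omega> \<in> space M. N [] \<omega> = a}"
    using assms by simp
  also have "\<dots> = expectation (\<lambda>\<omega>. 1 / a * indicator {\<omega> \<in> space M. N [] \<omega> = a} \<omega>)"
    by (simp add: Int_absorb2 subset_eq)
  also have "\<dots> \<le> expectation (\<lambda>\<omega>. 1 / N [] \<omega>)"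
  proof (rule integral_mono)
    show "integrable M (\<lambda>\<omega>. 1 / N [] \<omega>)"
      by (intro integrable_const_bound[of _ 1]) (auto simp: divide_le_eq)
    show "integrable M (\<lambda>\<omega>. 1 / a * indicator {\<omega> \<in> space M. N [] \<omega> = a} \<omega> :: real)"
      by (intro integrable_mult_right integrable_const_bound[of _ 1]) (auto simp: indicator_def)
  qed (auto simp: indicator_def)
  finally show ?thesis .
qed

lemma tree_events [measurable]: "{\<omega> \<in> space M. v \<in> tree \<omega>} \<in> events"
  by (induction v rule: rev_induct) (simp_all add: genealogical_tree_Nil genealogical_tree_snoc)

end

section \<open>The walk as a random process\<close>

locale branching_walk = branching_orrw \<delta> M p N for \<delta> and M :: "'w measure" and p N +
  fixes X :: "nat \<Rightarrow> 'w \<Rightarrow> vertex"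
  assumes walk: "once_reinforced_walk M \<delta> (\<lambda>\<omega>. genealogical_tree (\<lambda>v. N v \<omega>)) [] X"
begin

lemma measurable_X [measurable]: "X k \<in> measurable M (count_space UNIV)"
  using walk by (simp add: once_reinforced_walk_def)

abbreviation hist :: "nat \<Rightarrow> 'w measure" where
  "hist \<equiv> history_algebra M tree X"

lemma history_generators:
  "{{\<omega> \<in> space M. v \<in> tree \<omega>} | v. True} \<union> {{\<omega> \<in> space M. X j \<omega> = v} | j v. j \<le> k} \<subseteq> events"
  by auto

lemma space_hist: "space (hist k) = space M"
  by (simp add: history_algebra_def space_measure_of_conv)

lemma sets_hist: "sets (hist k) =
    sigma_sets (space M) ({{\<omega> \<in> space M. v \<in> tree \<omega>} | v. True} \<union> {{\<omega> \<in> space M. X j \<omega> = v} | j v. j \<le> k})"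
  unfolding history_algebra_def
  using history_generators[of k] sets.space_closed by (intro sets_measure_of) blast

lemma subalgebra_hist: "subalgebra M (hist k)"
  unfolding subalgebra_def space_hist sets_hist
  using sets.sigma_sets_subset[OF history_generators] by simp

lemma tree_hist: "{\<omega> \<in> space (hist k). v \<in> tree \<omega>} \<in> sets (hist k)"
  unfolding sets_hist space_hist by (rule sigma_sets.Basic) auto

lemma X_hist: "j \<le> k \<Longrightarrow> {\<omega> \<in> space (hist k). X j \<omega> = v} \<in> sets (hist k)"
  unfolding sets_hist space_hist by (rule sigma_sets.Basic) auto

definition positions :: "nat \<Rightarrow> 'w \<Rightarrow> vertex list" where
  "positions k \<omega> = map (\<lambda>j. X j \<omega>) [0..<Suc k]"

lemma measurable_positions: "positions k \<in> measurable (hist k) (count_space UNIV)"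
proof (subst measurable_count_space_eq_countable)
  show "countable (UNIV :: vertex list set)"
    by simp
  have "positions k -` {l} \<inter> space (hist k) \<in> sets (hist k)" for l
  proof (cases "length l = Suc k")
    case True
    have "positions k -` {l} \<inter> space (hist k) = {\<omega> \<in> space (hist k). \<forall>j\<in>{..k}. X j \<omega> = l ! j}"
      using True by (auto simp: positions_def list_eq_iff_nth_eq less_Suc_eq_le simp del: upt_Suc)
    also have "\<dots> \<in> sets (hist k)"
      by (intro sets.sets_Collect_finite_All X_hist) auto
    finally show ?thesis .
  next
    case False
    then have "positions k -` {l} \<inter> space (hist k) = {}"
      by (auto simp: positions_def)
    then show ?thesis
      by simp
  qed
  then show "positions k \<in> space (hist k) \<rightarrow> UNIV \<and>
      (\<forall>l\<in>UNIV. positions k -` {l} \<inter> space (hist k) \<in> sets (hist k))"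
    by simp
qed

abbreviation next_avoid :: "nat \<Rightarrow> nat \<Rightarrow> nat \<Rightarrow> vertex \<Rightarrow> 'w \<Rightarrow> real" where
  "next_avoid n B k y \<omega> \<equiv> avoid n B (tree \<omega>) ((\<lambda>j. X j \<omega>)(Suc k := y)) (Suc k)"

text \<open>There are countably many position lists, and for each of them finitely many tree events
  decide the value. Measurability for the history, not just for \<open>M\<close>, lets the factor
  pass through the conditional expectation.\<close>

lemma measurable_next_avoid: "next_avoid n B k y \<in> borel_measurable (hist k)"
proof -
  define f where "f l \<omega> = avoid n B (tree \<omega>) ((\<lambda>j. l ! j)(Suc k := y)) (Suc k)" for l :: "vertex list" and \<omega>
  have "f l \<in> borel_measurable (hist k)" for l
  proof -
    let ?x = "(\<lambda>j. l ! j)(Suc k := y)"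
    let ?A = "?x ` {..Suc k} \<union> block n B [0]"
    have "(\<lambda>\<omega>. tree \<omega> \<inter> ?A) \<in> measurable (hist k) (count_space (Pow ?A))"
      by (intro measurable_Int_finite tree_hist) (simp add: finite_block)
    then have "(\<lambda>\<omega>. avoid n B (tree \<omega> \<inter> ?A) ?x (Suc k)) \<in> borel_measurable (hist k)"
      by (rule measurable_compose) simp
    moreover have "avoid n B (tree \<omega> \<inter> ?A) ?x (Suc k) = f l \<omega>" for \<omega>
      unfolding f_def by (rule avoid_tree_cong) blast
    ultimately show ?thesis
      by simp
  qed
  then have "(\<lambda>\<omega>. f (positions k \<omega>) \<omega>) \<in> borel_measurable (hist k)"
    by (rule measurable_compose_countable[OF _ measurable_positions])
  moreover have "f (positions k \<omega>) \<omega> = next_avoid n B k y \<omega>" for \<omega>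
    unfolding f_def by (rule avoid_cong) (auto simp: positions_def le_Suc_eq nth_append simp del: upt_Suc)
  ultimately show ?thesis
    by simp
qed

text \<open>Split by the value \<open>y\<close> of \<open>X (Suc k)\<close>. For fixed
  \<open>y\<close> the other factor is known at time \<open>k\<close>, so the indicator of the event
  may be replaced by its conditional expectation, the step probability. Nonnegative integrals make
  the exchange with the sum over \<open>y\<close> unconditional.\<close>

lemma nn_integral_next_avoid:
  "(\<integral>\<^sup>+\<omega>. avoid n B (tree \<omega>) (\<lambda>j. X j \<omega>) (Suc k) \<partial>M) =
    (\<integral>\<^sup>+\<omega>. \<integral>\<^sup>+y. ennreal (orrw_step (tree_adj (tree \<omega>)) \<delta> (\<lambda>j. X j \<omega>) k y * next_avoid n B k y \<omega>) \<partial>count_space UNIV \<partial>M)"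
proof -
  define g where "g y = (indicator {\<omega> \<in> space M. X (Suc k) \<omega> = y} :: 'w \<Rightarrow> real)" for y
  define ce where "ce y = real_cond_exp M (hist k) (g y)" for y
  interpret sub: sigma_finite_subalgebra M "hist k"
    by (rule finite_measure_subalgebra_is_sigma_finite)
       (simp add: finite_measure_subalgebra_def finite_measure_subalgebra_axioms_def finite_measure_axioms subalgebra_hist)
  have mf: "next_avoid n B k y \<in> borel_measurable M" for y
    by (rule measurable_from_subalg[OF subalgebra_hist measurable_next_avoid])
  have mg [measurable]: "g y \<in> borel_measurable M" for y
    unfolding g_def by measurable
  have "AE \<omega> in M. \<forall>y. ce y \<omega> = orrw_step (tree_adj (tree \<omega>)) \<delta> (\<lambda>j. X j \<omega>) k y"
    using walk by (subst AE_all_countable) (simp add: once_reinforced_walk_def ce_def g_def)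
  then have ce: "AE \<omega> in M. \<forall>y. ce y \<omega> = orrw_step (tree_adj (tree \<omega>)) \<delta> (\<lambda>j. X j \<omega>) k y" .
  have mce [measurable]: "ce y \<in> borel_measurable M" for y
    unfolding ce_def by simp
  have one: "(\<integral>\<^sup>+\<omega>. ennreal (next_avoid n B k y \<omega> * g y \<omega>) \<partial>M) = (\<integral>\<^sup>+\<omega>. ennreal (next_avoid n B k y \<omega> * ce y \<omega>) \<partial>M)" for y
  proof -
    have int: "integrable M (\<lambda>\<omega>. next_avoid n B k y \<omega> * g y \<omega>)"
      using avoid_unit mf
      by (intro integrable_const_bound[of _ 1]) (auto simp: g_def indicator_def)
    have "(\<integral>\<^sup>+\<omega>. ennreal (next_avoid n B k y \<omega> * g y \<omega>) \<partial>M) = ennreal (\<integral>\<omega>. next_avoid n B k y \<omega> * g y \<omega> \<partial>M)"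
      by (intro nn_integral_eq_integral int AE_I2) (simp add: avoid_unit g_def)
    also have "(\<integral>\<omega>. next_avoid n B k y \<omega> * g y \<omega> \<partial>M) = (\<integral>\<omega>. next_avoid n B k y \<omega> * ce y \<omega> \<partial>M)"
      unfolding ce_def by (rule sub.real_cond_exp_intg(2)[OF int measurable_next_avoid mg, symmetric])
    also have "ennreal \<dots> = (\<integral>\<^sup>+\<omega>. ennreal (next_avoid n B k y \<omega> * ce y \<omega>) \<partial>M)"
    proof (rule nn_integral_eq_integral[symmetric])
      show "integrable M (\<lambda>\<omega>. next_avoid n B k y \<omega> * ce y \<omega>)"
        unfolding ce_def by (rule sub.real_cond_exp_intg(1)[OF int measurable_next_avoid mg])
      show "AE \<omega> in M. 0 \<le> next_avoid n B k y \<omega> * ce y \<omega>"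
        using ce by eventually_elim (simp add: avoid_unit orrw_step_nonneg)
    qed
    finally show ?thesis .
  qed
  have "(\<integral>\<^sup>+\<omega>. avoid n B (tree \<omega>) (\<lambda>j. X j \<omega>) (Suc k) \<partial>M) =
      (\<integral>\<^sup>+\<omega>. \<integral>\<^sup>+y. ennreal (next_avoid n B k y \<omega> * g y \<omega>) \<partial>count_space UNIV \<partial>M)"
  proof (rule nn_integral_cong)
    fix \<omega> assume w: "\<omega> \<in> space M"
    have "(\<integral>\<^sup>+y. ennreal (next_avoid n B k y \<omega> * g y \<omega>) \<partial>count_space UNIV) =
        (\<Sum>y\<in>{X (Suc k) \<omega>}. ennreal (next_avoid n B k y \<omega> * g y \<omega>))"
      by (rule nn_integral_count_space') (auto simp: g_def indicator_def)
    also have "\<dots> = ennreal (avoid n B (tree \<omega>) (\<lambda>j. X j \<omega>) (Suc k))"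
      using w by (simp add: g_def fun_upd_idem)
    finally show "ennreal (avoid n B (tree \<omega>) (\<lambda>j. X j \<omega>) (Suc k)) =
        (\<integral>\<^sup>+y. ennreal (next_avoid n B k y \<omega> * g y \<omega>) \<partial>count_space UNIV)"
      by simp
  qed
  also have "\<dots> = (\<integral>\<^sup>+y. \<integral>\<^sup>+\<omega>. ennreal (next_avoid n B k y \<omega> * g y \<omega>) \<partial>M \<partial>count_space UNIV)"
    using mf by (intro nn_integral_count_space_nn_integral) auto
  also have "\<dots> = (\<integral>\<^sup>+y. \<integral>\<^sup>+\<omega>. ennreal (next_avoid n B k y \<omega> * ce y \<omega>) \<partial>M \<partial>count_space UNIV)"
    by (simp only: one)
  also have "\<dots> = (\<integral>\<^sup>+\<omega>. \<integral>\<^sup>+y. ennreal (next_avoid n B k y \<omega> * ce y \<omega>) \<partial>count_space UNIV \<partial>M)"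
    using mf by (intro nn_integral_count_space_nn_integral[symmetric]) auto
  also have "\<dots> = (\<integral>\<^sup>+\<omega>. \<integral>\<^sup>+y. ennreal (orrw_step (tree_adj (tree \<omega>)) \<delta> (\<lambda>j. X j \<omega>) k y * next_avoid n B k y \<omega>) \<partial>count_space UNIV \<partial>M)"
    by (rule nn_integral_cong_AE) (use ce in \<open>eventually_elim, simp add: mult.commute\<close>)
  finally show ?thesis .
qed

lemma nn_integral_avoid_mono:
  assumes "1 \<le> k" "k \<le> n"
  shows "(\<integral>\<^sup>+\<omega>. avoid n B (tree \<omega>) (\<lambda>j. X j \<omega>) k \<partial>M) \<le> (\<integral>\<^sup>+\<omega>. avoid n B (tree \<omega>) (\<lambda>j. X j \<omega>) (Suc k) \<partial>M)"
  unfolding nn_integral_next_avoid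
proof (rule nn_integral_mono)
  fix \<omega>
  let ?s = "\<lambda>y. orrw_step (tree_adj (tree \<omega>)) \<delta> (\<lambda>j. X j \<omega>) k y * next_avoid n B k y \<omega>"
  let ?A = "{y. tree_adj (tree \<omega>) (X k \<omega>) y}"
  show "ennreal (avoid n B (tree \<omega>) (\<lambda>j. X j \<omega>) k) \<le> (\<integral>\<^sup>+y. ennreal (?s y) \<partial>count_space UNIV)"
  proof (cases "finite ?A")
    case True
    have "ennreal (avoid n B (tree \<omega>) (\<lambda>j. X j \<omega>) k) \<le> ennreal (\<Sum>y\<in>?A. ?s y)"
      using avoid_step[OF rooted_genealogical_tree assms, of B "\<lambda>v. N v \<omega>" "\<lambda>j. X j \<omega>"]
      by (intro ennreal_leI) simp
    also have "\<dots> = (\<Sum>y\<in>?A. ennreal (?s y))"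
      by (rule sum_ennreal[symmetric]) (simp add: orrw_step_nonneg avoid_unit)
    also have "\<dots> = (\<integral>\<^sup>+y. ennreal (?s y) \<partial>count_space ?A)"
      using True by (simp add: nn_integral_count_space_finite)
    also have "\<dots> \<le> (\<integral>\<^sup>+y. ennreal (?s y) \<partial>count_space UNIV)"
      by (simp add: nn_integral_count_space_indicator nn_integral_mono indicator_def split: if_split)
    finally show ?thesis .
  next
    case False
    \<comment> \<open>The sum over an infinite set is 0 by convention, so \<open>avoid_step\<close>
      itself disposes of this case.\<close>
    then have "avoid n B (tree \<omega>) (\<lambda>j. X j \<omega>) k \<le> 0"
      using avoid_step[OF rooted_genealogical_tree assms, of B "\<lambda>v. N v \<omega>" "\<lambda>j. X j \<omega>"] by simp
    then show ?thesis
      by (simp add: ennreal_neg)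
  qed
qed

lemma nn_integral_avoid_1:
  "ennreal (expectation (\<lambda>\<omega>. 1 / N [] \<omega>) * (1 - expectation (\<lambda>\<omega>. fresh n B \<omega> [0] 1))) \<le>
    (\<integral>\<^sup>+\<omega>. avoid n B (tree \<omega>) (\<lambda>j. X j \<omega>) (Suc 0) \<partial>M)"
proof -
  let ?f = "\<lambda>\<omega>. 1 / N [] \<omega> * (1 - fresh n B \<omega> [0] 1)"
  have f01: "0 \<le> ?f \<omega> \<and> ?f \<omega> \<le> 1" for \<omega>
    using no_escape_unit[of n B "kids \<omega>" "{}" "[]" "[0]" 1]
      mult_le_one[of "1 / real (N [] \<omega>)" "1 - fresh n B \<omega> [0] 1"]
    by (auto simp: divide_le_eq)
  have m: "?f \<in> borel_measurable M"
    using measurable_fresh by measurable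
  have "ennreal (expectation (\<lambda>\<omega>. 1 / N [] \<omega>) * (1 - expectation (\<lambda>\<omega>. fresh n B \<omega> [0] 1))) =
      ennreal (expectation ?f)"
    by (simp only: expectation_first_step)
  also have "\<dots> = (\<integral>\<^sup>+\<omega>. ennreal (?f \<omega>) \<partial>M)"
  proof (rule nn_integral_eq_integral[symmetric])
    have "norm (?f \<omega>) \<le> 1" for \<omega>
      using f01[of \<omega>] by (simp only: real_norm_def abs_of_nonneg)
    then show "integrable M ?f"
      using m by (intro integrable_const_bound[of _ 1] AE_I2)
  qed (use f01 in blast)
  also have "\<dots> \<le> (\<integral>\<^sup>+\<omega>. \<integral>\<^sup>+y. ennreal (orrw_step (tree_adj (tree \<omega>)) \<delta> (\<lambda>j. X j \<omega>) 0 y * next_avoid n B 0 y \<omega>) \<partial>count_space UNIV \<partial>M)"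
  proof (rule nn_integral_mono_AE)
    have "AE \<omega> in M. X 0 \<omega> = []"
      using walk by (simp add: once_reinforced_walk_def)
    then show "AE \<omega> in M. ennreal (?f \<omega>) \<le>
        (\<integral>\<^sup>+y. ennreal (orrw_step (tree_adj (tree \<omega>)) \<delta> (\<lambda>j. X j \<omega>) 0 y * next_avoid n B 0 y \<omega>) \<partial>count_space UNIV)"
    proof eventually_elim
      case (elim \<omega>)
      let ?s = "\<lambda>y. orrw_step (tree_adj (tree \<omega>)) \<delta> (\<lambda>j. X j \<omega>) 0 y * next_avoid n B 0 y \<omega>"
      show ?case
      proof (cases "N [] \<omega> = 0")
        case False
        have child: "[i] \<in> tree \<omega> \<longleftrightarrow> i < N [] \<omega>" for i
          using genealogical_tree_snoc[of "[]" i "\<lambda>v. N v \<omega>"] by (simp add: genealogical_tree_Nil)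
        then have c: "[0] \<in> tree \<omega>" "card {i. [i] \<in> tree \<omega>} = N [] \<omega>"
          using False by (simp_all add: lessThan_def[symmetric])
        have "?s [0] = ?f \<omega>"
          using avoid_first_step[OF rooted_genealogical_tree _ c(1), of "\<lambda>j. X j \<omega>" n B] elim
            no_escape_tree[OF c(1), of n B "{}" "[]" 1] by (simp add: c(2))
        then have "ennreal (?f \<omega>) = (\<integral>\<^sup>+y. ennreal (?s y) * indicator {[0]} y \<partial>count_space UNIV)"
          by (simp add: nn_integral_count_space_indicator[symmetric] nn_integral_indicator_singleton')
        also have "\<dots> \<le> (\<integral>\<^sup>+y. ennreal (?s y) \<partial>count_space UNIV)"
          by (intro nn_integral_mono) (simp add: indicator_def)
        finally show ?thesis .
      qed simp
    qed
  qed
  finally show ?thesis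
    by (simp only: nn_integral_next_avoid)
qed

text \<open>With the depth equal to the time horizon \<open>k\<close>, the submartingale can be
  followed from time 1 to \<open>k\<close>, where it is at most the indicator of no return. The
  lower bound does not involve \<open>k\<close>.\<close>

lemma prob_avoid_ge:
  assumes "1 \<le> k"
    and h: "\<And>k. 0 \<le> h k \<and> h k \<le> 1" "h 0 = 1"
    and super: "\<And>k. gamma_mean k (\<lambda>t. \<Sum>a\<le>B. measure_pmf.prob p {n. min n B = a} * delayed h t ^ a) \<le> h k"
  shows "expectation (\<lambda>\<omega>. 1 / N [] \<omega>) * (1 - h 1) \<le> prob {\<omega> \<in> space M. \<forall>j\<in>{1..k}. X j \<omega> \<noteq> []}"
proof -
  let ?c = "expectation (\<lambda>\<omega>. 1 / N [] \<omega>)"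
  let ?I = "\<lambda>j. \<integral>\<^sup>+\<omega>. avoid k B (tree \<omega>) (\<lambda>j. X j \<omega>) j \<partial>M"
  have "0 \<le> ?c"
    by (intro Bochner_Integration.integral_nonneg) auto
  then have "?c * (1 - h 1) \<le> ?c * (1 - expectation (\<lambda>\<omega>. fresh k B \<omega> [0] 1))"
    using expectation_fresh_le[OF h super, of k "[0]" 1] by (intro mult_left_mono) auto
  then have "ennreal (?c * (1 - h 1)) \<le> ?I (Suc 0)"
    using nn_integral_avoid_1[of k B] by (meson ennreal_leI order.trans)
  also have "?I (Suc 0) \<le> ?I j" if "1 \<le> j" "j \<le> k" for j
    using that
  proof (induction j rule: dec_induct)
    case (step j)
    then show ?case
      using nn_integral_avoid_mono[of j k B] by simp
  qed simp
  from this[of k] assms(1) have "?I (Suc 0) \<le> ?I k"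
    by simp
  also have "?I k \<le> (\<integral>\<^sup>+\<omega>. indicator {\<omega> \<in> space M. \<forall>j\<in>{1..k}. X j \<omega> \<noteq> []} \<omega> \<partial>M)"
  proof (rule nn_integral_mono)
    fix \<omega> assume w: "\<omega> \<in> space M"
    show "ennreal (avoid k B (tree \<omega>) (\<lambda>j. X j \<omega>) k) \<le> indicator {\<omega> \<in> space M. \<forall>j\<in>{1..k}. X j \<omega> \<noteq> []} \<omega>"
    proof (cases "\<forall>j\<in>{1..k}. X j \<omega> \<noteq> []")
      case True
      then show ?thesis
        using w avoid_unit by (simp add: ennreal_le_1)
    next
      case False
      then have "avoid k B (tree \<omega>) (\<lambda>j. X j \<omega>) k = 0"
        by (auto simp: avoid_def)
      then show ?thesis
        by simp
    qed
  qed
  also have "\<dots> = ennreal (prob {\<omega> \<in> space M. \<forall>j\<in>{1..k}. X j \<omega> \<noteq> []})"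
    by (subst nn_integral_indicator) (auto simp: emeasure_eq_measure)
  finally show ?thesis
    by (simp add: ennreal_le_iff)
qed

lemma prob_no_return_ge:
  assumes c: "\<And>k. 1 \<le> k \<Longrightarrow> c \<le> prob {\<omega> \<in> space M. \<forall>j\<in>{1..k}. X j \<omega> \<noteq> []}"
  shows "c \<le> prob {\<omega> \<in> space M. return_time [] (\<lambda>k. X k \<omega>) = \<infinity>}"
proof -
  let ?A = "\<lambda>k. {\<omega> \<in> space M. \<forall>j\<in>{1..k}. X j \<omega> \<noteq> []}"
  have "(\<lambda>k. prob (?A k)) \<longlonglongrightarrow> prob (\<Inter>k. ?A k)"
    by (rule finite_Lim_measure_decseq) (auto simp: decseq_def)
  then have "c \<le> prob (\<Inter>k. ?A k)"
    using c by (intro LIMSEQ_le_const[of _ _ c]) auto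
  also have "(\<Inter>k. ?A k) = {\<omega> \<in> space M. return_time [] (\<lambda>k. X k \<omega>) = \<infinity>}"
  proof -
    have "return_time [] x = \<infinity> \<longleftrightarrow> (\<forall>j\<ge>1. x j \<noteq> [])" for x :: "nat \<Rightarrow> vertex"
      unfolding return_time_def top_enat_def[symmetric] INF_top_conv by (auto simp: top_enat_def)
    moreover have "(\<forall>k. \<forall>j\<in>{1..k}. P j) \<longleftrightarrow> (\<forall>j\<ge>1. P j)" for P :: "nat \<Rightarrow> bool"
      by (metis atLeastAtMost_iff order_refl)
    ultimately show ?thesis
      by auto
  qed
  finally show ?thesis .
qed

end

theorem theorem2:
  fixes M :: "'w measure"
    and p :: "nat pmf"
    and m \<delta> :: real
    and N :: "vertex \<Rightarrow> 'w \<Rightarrow> nat"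
    and X :: "nat \<Rightarrow> 'w \<Rightarrow> vertex"
  assumes "prob_space M"
    and "branching_offspring M p N"
    and "integrable (measure_pmf p) real"
    and "measure_pmf.expectation p real = m"
    and "1 < m"
    and "0 < \<delta>"
    and "once_reinforced_walk M \<delta> (\<lambda>\<omega>. genealogical_tree (\<lambda>v. N v \<omega>)) [] X"
  shows "transient M [] X"
proof -
  interpret prob_space M
    by (rule assms(1))
  interpret branching_walk \<delta> M p N X
    by unfold_locales (use assms in auto)
  obtain B where B: "1 < (\<Sum>a\<le>B. measure_pmf.prob p {n. min n B = a} * a)"
    "(\<Sum>a\<le>B. measure_pmf.prob p {n. min n B = a}) = 1"
    using truncated_mean[of p] assms(3-5) by auto
  obtain h where h: "\<And>k. 0 \<le> h k \<and> h k \<le> 1" "h 0 = 1" "h 1 < 1"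
    "\<And>k. gamma_mean k (\<lambda>t. \<Sum>a\<le>B. measure_pmf.prob p {n. min n B = a} * delayed h t ^ a) \<le> h k"
    using exists_supersolution[OF _ B(2,1)] by auto
  \<comment> \<open>A positive offspring number has positive mass because the mean is not 0; this
    makes the expectation of \<open>1 / N []\<close> positive.\<close>
  obtain a where a: "0 < pmf p a" "0 < a"
  proof (rule ccontr)
    assume "\<not> thesis"
    have "AE n in p. real n = 0"
    proof (rule AE_pmfI)
      fix n assume "n \<in> set_pmf p"
      then show "real n = 0"
        using that[of n] \<open>\<not> thesis\<close> pmf_positive[of n p] by auto
    qed
    then have "measure_pmf.expectation p real = 0"
      by (simp add: integral_eq_zero_AE)
    then show False
      using assms(4,5) by simp
  qed
  have "0 < expectation (\<lambda>\<omega>. 1 / N [] \<omega>) * (1 - h 1)"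
    using expectation_first_step_pos[OF a] h(3) by simp
  also have "\<dots> \<le> prob {\<omega> \<in> space M. return_time [] (\<lambda>k. X k \<omega>) = \<infinity>}"
    using prob_avoid_ge[OF _ h(1,2,4)] by (intro prob_no_return_ge)
  finally show ?thesis
    by (simp add: transient_def)
qed

end
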